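(* Let $\kappa>0$ and let $(X,d)$ be a locally compact, uniquely geodesic $\mathrm{CAT}(\kappa)$ space such that for every $p\in X$ the space $X$ has the geodesic extension property around $p$ with a constant $R_p<\frac{\pi}{2\sqrt{\kappa}}$. Let $f:X\to(-\infty,\infty]$ be a convex function and let $x\in\operatorname{dom} f$. If $f$ is continuous at $x$, then $\partial f(x)\neq\emptyset$.
   Context: Geodesics. A geodesic is an isometric map $\gamma:[0,l]\to X$; it issues at $\gamma(0)$. $X$ is uniquely geodesic if every two points are joined by a unique geodesic segment. $C\subseteq X$ is convex if it contains every geodesic segment joining two of its points. $X$ has the geodesic extension property around $p\in X$ with constant $R>0$ if for any distinct $y,z\in B(p,R)$ with $d(y,z)<R$, the geodesic from $y$ to $z$ can be extended beyond $z$ to a geodesic of length $R$. A $\mathrm{CAT}(\kappa)$ space ($\kappa>0$) is a metric space in which points at distance less than $\pi/\sqrt\kappa$ are joined by a geodesic and geodesic triangles of perimeter less than $2\pi/\sqrt\kappa$ are not thicker than their comparison triangles in the simply connected surface of constant curvature $\kappa$. Tangent space. For $x\in X$, $\Sigma_xX$ is the set of equivalence classes $[\gamma]$ of nonconstant geodesics issuing at $x$, where $\gamma\sim\eta$ iff the Alexandrov angle $\angle(\gamma,\eta)$ is $0$. By geodesic extension, a representative may always be taken of length at least $R_x$. The tangent space $T_xX$ is the Euclidean cone over $(\Sigma_xX,\angle)$: its elements are pairs $([\gamma],r)$ with $[\gamma]\in\Sigma_xX$, $r\ge0$, all pairs with $r=0$ being identified to one point $o_x$, the origin (for $o_x$ the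 geodesic may also be taken constantly equal to $x$). Normal cone. For a uniquely geodesic space $Y$ of this kind, $C\subseteq Y$ nonempty convex and $y\in C$, let $P_C(z)=\{c\in C: d(z,c)=\operatorname{dist}(z,C)\}$ and $N_C(y)=\{([\gamma],r)\in T_yY : r=0 \text{ or } P_C(\gamma(t))=\{y\}\text{ for some }t>0\}$. Functions. $f:X\to(-\infty,\infty]$ is convex if $f(\gamma(lt))\le(1-t)f(\gamma(0))+tf(\gamma(l))$ for every geodesic $\gamma:[0,l]\to X$ and $t\in[0,1]$; $\operatorname{dom} f=\{f<\infty\}$; $\operatorname{epi} f=\{(x,\lambda)\in\operatorname{dom} f\times\mathbb{R}:\lambda\ge f(x)\}$. Subdifferential. $X\times\mathbb{R}$ carries the metric $d_2((x_1,y_1),(x_2,y_2))=\sqrt{d(x_1,x_2)^2+|y_1-y_2|^2}$. For $f$ convex and $x\in\operatorname{dom} f$, $([\gamma],r)\in T_xX$ is a subgradient of $f$ at $x$ if $([\sigma],1)\in N_{\operatorname{epi} f}(x,f(x))$ (normal cone in $X\times\mathbb{R}$), where $\sigma:[0,R_x]\to X\times\mathbb{R}$, $\sigma(t)=\left(\gamma\left(rt/\sqrt{r^2+1}\right),\,f(x)-t/\sqrt{r^2+1}\right)$. The set of subgradients is $\partial f(x)$. *)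

theory Defs
  imports "HOL-Analysis.Analysis"
begin

section \<open>Geodesics\<close>

text \<open>A geodesic \<open>[0,l] \<rightarrow> M\<close> is a function on \<^typ>\<open>real\<close> whose values outside
  \<open>{0..l}\<close> are irrelevant. The metric is a parameter so that the notion also applies to the
  comparison surface; the space \<open>X\<close> itself is a type of class \<^class>\<open>metric_space\<close>.\<close>

definition geodesic_in :: "'a set \<Rightarrow> ('a \<Rightarrow> 'a \<Rightarrow> real) \<Rightarrow> real \<Rightarrow> (real \<Rightarrow> 'a) \<Rightarrow> bool"
  where "geodesic_in M d l \<gamma> \<longleftrightarrow>
    0 \<le> l \<and> \<gamma> ` {0..l} \<subseteq> M \<and> (\<forall>s\<in>{0..l}. \<forall>t\<in>{0..l}. d (\<gamma> s) (\<gamma> t) = \<bar>s - t\<bar>)"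

abbreviation geodesic :: "real \<Rightarrow> (real \<Rightarrow> 'a::metric_space) \<Rightarrow> bool"
  where "geodesic \<equiv> geodesic_in UNIV dist"

definition geodesic_segment :: "'a::metric_space \<Rightarrow> 'a \<Rightarrow> 'a set \<Rightarrow> bool"
  where "geodesic_segment y z S \<longleftrightarrow>
    (\<exists>l \<gamma>. geodesic l \<gamma> \<and> \<gamma> 0 = y \<and> \<gamma> l = z \<and> S = \<gamma> ` {0..l})"

definition uniquely_geodesic :: "'a::metric_space itself \<Rightarrow> bool"
  where "uniquely_geodesic _ \<longleftrightarrow> (\<forall>(y::'a) z. \<exists>!S. geodesic_segment y z S)"

definition geodesic_extension_around :: "'a::metric_space \<Rightarrow> real \<Rightarrow> bool"
  where "geodesic_extension_around p R \<longleftrightarrow> 0 < R \<and>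
    (\<forall>y\<in>ball p R. \<forall>z\<in>ball p R. \<forall>\<sigma>.
       y \<noteq> z \<and> dist y z < R \<and> geodesic (dist y z) \<sigma> \<and> \<sigma> 0 = y \<and> \<sigma> (dist y z) = z \<longrightarrow>
       (\<exists>\<eta>. geodesic R \<eta> \<and> (\<forall>t\<in>{0..dist y z}. \<eta> t = \<sigma> t)))"

section \<open>Upper curvature bounds\<close>

text \<open>The simply connected surface of constant curvature \<open>\<kappa> > 0\<close>: the Euclidean sphere of
  radius \<open>1 / sqrt \<kappa>\<close> in \<open>\<real>\<^sup>3\<close> with its arc-length metric.\<close>

definition model_surface :: "real \<Rightarrow> (real^3) set"
  where "model_surface \<kappa> = sphere 0 (1 / sqrt \<kappa>)"

definition model_dist :: "real \<Rightarrow> real^3 \<Rightarrow> real^3 \<Rightarrow> real"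
  where "model_dist \<kappa> u v = arccos (\<kappa> * (u \<bullet> v)) / sqrt \<kappa>"

text \<open>A triangle consists of three geodesic sides \<open>\<sigma> 0, \<sigma> 1, \<sigma> 2\<close> of lengths
  \<open>l 0, l 1, l 2\<close>, each ending where the next one starts. A comparison triangle is one
  in the model surface with the same side lengths; the point of parameter \<open>s\<close> on a side corresponds to
  the point of parameter \<open>s\<close> on the comparison side.\<close>

definition geodesic_triangle_in ::
    "'a set \<Rightarrow> ('a \<Rightarrow> 'a \<Rightarrow> real) \<Rightarrow> (nat \<Rightarrow> real) \<Rightarrow> (nat \<Rightarrow> real \<Rightarrow> 'a) \<Rightarrow> bool"
  where "geodesic_triangle_in M d l \<sigma> \<longleftrightarrow>
    (\<forall>i<3. geodesic_in M d (l i) (\<sigma> i) \<and> \<sigma> i (l i) = \<sigma> (Suc i mod 3) 0)"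

definition CAT_space :: "real \<Rightarrow> 'a::metric_space itself \<Rightarrow> bool"
  where "CAT_space \<kappa> _ \<longleftrightarrow>
    (\<forall>(y::'a) z. dist y z < pi / sqrt \<kappa> \<longrightarrow> (\<exists>l \<gamma>. geodesic l \<gamma> \<and> \<gamma> 0 = y \<and> \<gamma> l = z)) \<and>
    (\<forall>l (\<sigma> :: nat \<Rightarrow> real \<Rightarrow> 'a) \<sigma>'.
       geodesic_triangle_in UNIV dist l \<sigma> \<and> l 0 + l 1 + l 2 < 2 * pi / sqrt \<kappa> \<and>
       geodesic_triangle_in (model_surface \<kappa>) (model_dist \<kappa>) l \<sigma>' \<longrightarrow>
       (\<forall>i<3. \<forall>j<3. \<forall>s\<in>{0..l i}. \<forall>t\<in>{0..l j}.
          dist (\<sigma> i s) (\<sigma> j t) \<le> model_dist \<kappa> (\<sigma>' i s) (\<sigma>' j t)))"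

section \<open>Tangent spaces\<close>

text \<open>Alexandrov angle of two geodesics with the same starting point: the upper limit, as
  \<open>s\<close> and \<open>t\<close> tend to \<open>0\<close> independently, of the Euclidean comparison angle.\<close>

definition alexandrov_angle :: "(real \<Rightarrow> 'a::metric_space) \<Rightarrow> (real \<Rightarrow> 'a) \<Rightarrow> real"
  where "alexandrov_angle \<gamma> \<eta> = real_of_ereal
    (Limsup (at_right 0 \<times>\<^sub>F at_right 0)
      (\<lambda>(s, t). ereal (arccos ((s\<^sup>2 + t\<^sup>2 - (dist (\<gamma> s) (\<eta> t))\<^sup>2) / (2 * s * t)))))"

definition geodesics_from :: "'a::metric_space \<Rightarrow> (real \<times> (real \<Rightarrow> 'a)) set"
  where "geodesics_from x = {(l, \<gamma>). 0 < l \<and> geodesic l \<gamma> \<and> \<gamma> 0 = x}"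

definition same_direction ::
    "'a::metric_space \<Rightarrow> ((real \<times> (real \<Rightarrow> 'a)) \<times> (real \<times> (real \<Rightarrow> 'a))) set"
  where "same_direction x = {(g, h).
    g \<in> geodesics_from x \<and> h \<in> geodesics_from x \<and> alexandrov_angle (snd g) (snd h) = 0}"

type_synonym 'a direction = "(real \<times> (real \<Rightarrow> 'a)) set"

definition direction_of :: "'a::metric_space \<Rightarrow> real \<Rightarrow> (real \<Rightarrow> 'a) \<Rightarrow> 'a direction"
  where "direction_of x l \<gamma> = same_direction x `` {(l, \<gamma>)}"

definition directions :: "'a::metric_space \<Rightarrow> 'a direction set"
  where "directions x = geodesics_from x // same_direction x"

text \<open>\<open>Apex\<close> is the point obtained by identifying all pairs with second component \<open>0\<close>; it
  belongs to the cone also if there are no directions. The pair \<open>(u, r)\<close> with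
  \<open>r > 0\<close> is \<open>Ray u r\<close>.\<close>

datatype 'd cone_point = Apex | Ray 'd real

definition tangent_space :: "'a::metric_space \<Rightarrow> 'a direction cone_point set"
  where "tangent_space x = insert Apex {Ray u r | u r. u \<in> directions x \<and> 0 < r}"

section \<open>Normal cones and subgradients\<close>

definition proj_set :: "'a::metric_space set \<Rightarrow> 'a \<Rightarrow> 'a set"
  where "proj_set C z = {c \<in> C. dist z c = infdist z C}"

definition normal_cone :: "'a::metric_space set \<Rightarrow> 'a \<Rightarrow> 'a direction cone_point set"
  where "normal_cone C y = {v \<in> tangent_space y.
    case v of Apex \<Rightarrow> True
      | Ray u r \<Rightarrow> \<exists>(l, \<gamma>)\<in>u. \<exists>t\<in>{0<..l}. proj_set C (\<gamma> t) = {y}}"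

definition geodesically_convex_fun :: "('a::metric_space \<Rightarrow> ereal) \<Rightarrow> bool"
  where "geodesically_convex_fun f \<longleftrightarrow>
    (\<forall>l \<gamma>. geodesic l \<gamma> \<longrightarrow> (\<forall>t\<in>{0..1}.
       f (\<gamma> (l * t)) \<le> ereal (1 - t) * f (\<gamma> 0) + ereal t * f (\<gamma> l)))"

definition eff_dom :: "('a \<Rightarrow> ereal) \<Rightarrow> 'a set"
  where "eff_dom f = {x. f x < \<infinity>}"

definition epi :: "('a \<Rightarrow> ereal) \<Rightarrow> ('a \<times> real) set"
  where "epi f = {(x, c). x \<in> eff_dom f \<and> f x \<le> ereal c}"

definition downward_geodesic :: "(real \<Rightarrow> 'a) \<Rightarrow> real \<Rightarrow> real \<Rightarrow> real \<Rightarrow> 'a \<times> real"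
  where "downward_geodesic \<gamma> r a t = (\<gamma> (r * t / sqrt (r\<^sup>2 + 1)), a - t / sqrt (r\<^sup>2 + 1))"

text \<open>\<open>R\<close> is the geodesic extension constant at \<open>x\<close>, and the product type
  \<^typ>\<open>'a \<times> real\<close> carries the \<open>\<ell>\<^sup>2\<close> product metric. A subgradient with \<open>r = 0\<close> is represented
  by the constant curve at \<open>x\<close>.\<close>

definition subdifferential ::
    "real \<Rightarrow> ('a::metric_space \<Rightarrow> ereal) \<Rightarrow> 'a \<Rightarrow> 'a direction cone_point set"
  where "subdifferential R f x =
    (let a = real_of_ereal (f x);
         is_normal = (\<lambda>\<gamma> r. Ray (direction_of (x, a) R (downward_geodesic \<gamma> r a)) 1
                        \<in> normal_cone (epi f) (x, a))
     in {v \<in> tangent_space x.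
          case v of Apex \<Rightarrow> is_normal (\<lambda>_. x) 0
            | Ray u r \<Rightarrow> \<exists>(l, \<gamma>)\<in>u. R \<le> l \<and> is_normal \<gamma> r})"

end

theory Submission
  imports Defs
begin

text \<open>If \<open>x\<close> minimises \<open>f\<close>, the vertical downward direction is normal to the epigraph. Otherwise let
  \<open>z\<close> minimise \<open>f + d(x, \<cdot>)\<^sup>2 / (2 \<tau>)\<close> on a small compact ball. The first variation of this functional
  along geodesics issuing at \<open>z\<close> bounds \<open>f(y) - f(z)\<close> from below by \<open>(d(x, z) / \<tau>) d(z, y) cos \<beta>\<close>, where
  \<open>\<beta>\<close> is the comparison angle at \<open>z\<close> between \<open>x\<close> and \<open>y\<close>. Extend the geodesic from \<open>z\<close> to \<open>x\<close> beyond \<open>x\<close>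
  by a fixed small amount \<open>s\<close>. As \<open>\<tau>\<close> tends to \<open>0\<close>, the ratios \<open>d(x, z) / \<tau>\<close> and the endpoints of the
  extended geodesics subconverge to some \<open>m > 0\<close> and to a point \<open>w\<close>, and the CAT inequality turns the
  variational bound into a lower bound on \<open>d(w, y)\<close> in terms of \<open>(f(y) - f(x)) / m\<close>. For small \<open>s\<close> this
  makes \<open>(x, f(x))\<close> the only nearest point of the epigraph to \<open>(w, f(x) - s / m)\<close>, so the geodesic from
  \<open>x\<close> through \<open>w\<close>, with length \<open>m\<close>, is a subgradient.\<close>

section \<open>Comparison with the sphere\<close>

text \<open>Twice \<open>a\<close> is at most the perimeter, so \<open>a \<le> pi\<close>, and
  cosine decreases on that range. If \<open>b + c\<close> exceeds \<open>pi\<close>, it is reflected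
  to \<open>2 * pi - (b + c)\<close>, which has the same cosine and is at least \<open>a\<close> by
  the perimeter bound.\<close>

lemma cos_le_cos_side:
  fixes a b c :: real
  assumes "0 \<le> a" "0 \<le> b" "0 \<le> c" "a \<le> b + c" "b \<le> a + c" "c \<le> a + b" "a + b + c \<le> 2 * pi"
  shows "cos (b + c) \<le> cos a" "cos a \<le> cos (b - c)"
proof -
  show "cos a \<le> cos (b - c)"
    using cos_monotone_0_pi_le[of "\<bar>b - c\<bar>" a] assms by auto
  show "cos (b + c) \<le> cos a"
  proof (cases "b + c \<le> pi")
    case True
    then show ?thesis using cos_monotone_0_pi_le[of a "b + c"] assms by auto
  next
    case False
    then show ?thesis using cos_monotone_0_pi_le[of a "2 * pi - (b + c)"] assms
      by (auto simp: cos_diff)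
  qed
qed

text \<open>With \<open>u\<close> on the first axis and \<open>v\<close> in the plane of the first
  two, only the angle at \<open>u\<close> remains to be found; the spherical law of cosines
  prescribes its cosine \<open>X\<close>.\<close>

lemma spherical_triangle_exists:
  fixes a b c :: real
  assumes "0 \<le> a" "0 \<le> b" "0 \<le> c" "a \<le> b + c" "b \<le> a + c" "c \<le> a + b" "a + b + c \<le> 2 * pi"
  obtains u v w :: "real^3" where "u \<bullet> u = 1" "v \<bullet> v = 1" "w \<bullet> w = 1"
    "u \<bullet> v = cos c" "v \<bullet> w = cos a" "u \<bullet> w = cos b"
proof -
  define X where "X = (cos a - cos b * cos c) / (sin b * sin c)"
  have bd: "\<bar>cos a - cos b * cos c\<bar> \<le> sin b * sin c"
    using cos_le_cos_side[OF assms] unfolding cos_add cos_diff by linarith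
  \<comment> \<open>If \<open>sin b * sin c = 0\<close>, the division gives \<open>X = 0\<close>,
    and \<open>bd\<close> forces the right-hand side to vanish as well.\<close>
  have X: "sin b * sin c * X = cos a - cos b * cos c"
    using bd unfolding X_def by (cases "sin b * sin c = 0") auto
  have "\<bar>cos a - cos b * cos c\<bar> \<le> \<bar>sin b * sin c\<bar>" using bd by linarith
  then have "\<bar>X\<bar> \<le> 1"
    unfolding X_def abs_divide by (cases "sin b * sin c = 0") (auto simp: divide_le_eq_1)
  then have X1: "0 \<le> 1 - X\<^sup>2" by (simp add: abs_square_le_1)
  let ?u = "vector [1, 0, 0] :: real^3"
  let ?v = "vector [cos c, sin c, 0] :: real^3"
  let ?w = "vector [cos b, sin b * X, sin b * sqrt (1 - X\<^sup>2)] :: real^3"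
  show thesis
  proof (rule that[of ?u ?v ?w])
    show "?v \<bullet> ?v = 1"
      using sin_cos_squared_add[of c] by (simp add: inner_vec_def sum_3 power2_eq_square)
    have "(cos b)\<^sup>2 + (sin b)\<^sup>2 * X\<^sup>2 + (sin b)\<^sup>2 * (sqrt (1 - X\<^sup>2))\<^sup>2 = 1"
      using sin_cos_squared_add[of b] X1 by (simp add: algebra_simps)
    then show "?w \<bullet> ?w = 1"
      by (simp add: inner_vec_def sum_3 power2_eq_square algebra_simps)
    show "?v \<bullet> ?w = cos a"
      using X by (simp add: inner_vec_def sum_3 algebra_simps)
  qed (simp_all add: inner_vec_def sum_3)
qed

text \<open>For \<open>\<theta> = 0\<close> the division by \<open>sin \<theta>\<close> gives \<open>0\<close>, which is harmless because the arc is then a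
  single point.\<close>

definition great_arc :: "real \<Rightarrow> real^3 \<Rightarrow> real^3 \<Rightarrow> real \<Rightarrow> real \<Rightarrow> real^3"
  where "great_arc k u v \<theta> t =
    (1 / k) *\<^sub>R (cos (k * t) *\<^sub>R u + (sin (k * t) / sin \<theta>) *\<^sub>R (v - cos \<theta> *\<^sub>R u))"

lemma great_arc_0 [simp]: "great_arc k u v \<theta> 0 = (1 / k) *\<^sub>R u"
  by (simp add: great_arc_def)

lemma great_arc_end:
  assumes "k > 0" "u \<bullet> u = 1" "v \<bullet> v = 1" "u \<bullet> v = cos (k * l)" "0 \<le> k * l" "k * l < pi"
  shows "great_arc k u v (k * l) l = (1 / k) *\<^sub>R v"
proof (cases "l = 0")
  case True
  have "(u - v) \<bullet> (u - v) = 0"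
    using assms True by (simp add: inner_diff_left inner_diff_right inner_commute)
  then show ?thesis using True by simp
next
  case False
  then have "0 < l" using assms by (simp add: zero_le_mult_iff)
  then have "sin (k * l) > 0" using assms by (intro sin_gt_zero) auto
  then show ?thesis by (simp add: great_arc_def)
qed

lemma geodesic_in_great_arc:
  assumes "\<kappa> > 0" and k: "k = sqrt \<kappa>"
    and uv: "u \<bullet> u = 1" "v \<bullet> v = 1" "u \<bullet> v = cos (k * l)" and l: "0 \<le> l" "k * l < pi"
  shows "geodesic_in (model_surface \<kappa>) (model_dist \<kappa>) l (great_arc k u v (k * l))"
proof -
  have k0: "k > 0" "k * k = \<kappa>" using assms by auto
  define g where "g = great_arc k u v (k * l)"
  have inn: "\<kappa> * (g s \<bullet> g t) = cos (k * (s - t))" if "s \<in> {0..l}" "t \<in> {0..l}" for s t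
  proof (cases "l = 0")
    case True
    then show ?thesis using that uv k0 assms(1) by (simp add: g_def)
  next
    case False
    then have s0: "sin (k * l) \<noteq> 0"
      using l k0 sin_gt_zero[of "k * l"] by auto
    \<comment> \<open>Gram-Schmidt: \<open>u\<close> and \<open>e\<close> are orthonormal, and in
      this basis the arc is a circle parametrised by the angle \<open>k * t\<close>.\<close>
    define e where "e = (1 / sin (k * l)) *\<^sub>R (v - cos (k * l) *\<^sub>R u)"
    have ue: "u \<bullet> e = 0"
      using uv by (simp add: e_def inner_diff_right)
    have "(v - cos (k * l) *\<^sub>R u) \<bullet> (v - cos (k * l) *\<^sub>R u) = 1 - (cos (k * l))\<^sup>2"
      using uv by (simp add: inner_diff_right inner_diff_left inner_commute power2_eq_square)
    then have ee: "e \<bullet> e = 1"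
      using s0 unfolding e_def by (simp flip: sin_squared_eq) (simp add: power2_eq_square)
    have "g t = (1 / k) *\<^sub>R (cos (k * t) *\<^sub>R u + sin (k * t) *\<^sub>R e)" for t
      by (simp add: g_def great_arc_def e_def)
    then have "g s \<bullet> g t = 1 / k * (1 / k * (cos (k * s) * cos (k * t) + sin (k * s) * sin (k * t)))"
      using ue ee uv by (simp add: inner_add_left inner_add_right inner_commute[of e u] add_divide_distrib mult.commute)
    then show ?thesis
      using k0(1) by (simp add: k0(2)[symmetric] right_diff_distrib cos_diff)
  qed
  have n: "g t \<in> model_surface \<kappa>" if "t \<in> {0..l}" for t
  proof -
    have "\<kappa> * (g t \<bullet> g t) = 1" using inn[OF that that] by simp
    then have "(norm (g t))\<^sup>2 = (1 / k)\<^sup>2"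
      unfolding power2_norm_eq_inner using k0 assms(1) by (simp add: power2_eq_square field_simps)
    then have "norm (g t) = 1 / k" using k0 power2_eq_imp_eq[of "norm (g t)" "1 / k"] by simp
    then show ?thesis by (simp add: model_surface_def k)
  qed
  have "model_dist \<kappa> (g s) (g t) = \<bar>s - t\<bar>" if st: "s \<in> {0..l}" "t \<in> {0..l}" for s t
  proof -
    have "k * \<bar>s - t\<bar> \<le> k * l" using st k0 by (intro mult_left_mono) auto
    then have "k * \<bar>s - t\<bar> \<le> pi" using l by linarith
    then have "arccos (cos (k * \<bar>s - t\<bar>)) = k * \<bar>s - t\<bar>"
      using k0(1) by (intro arccos_cos) auto
    moreover have "cos (k * \<bar>s - t\<bar>) = cos (k * (s - t))"
      using cos_abs_real[of "k * (s - t)"] k0 by (simp add: abs_mult)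
    ultimately show ?thesis
      using inn[OF st] k0 k by (simp add: model_dist_def)
  qed
  then show ?thesis using n l unfolding geodesic_in_def g_def by auto
qed

text \<open>A point of the arc is the spherical interpolation of \<open>u\<close> and
  \<open>v\<close> with weights \<open>sin (k * (l - t))\<close> and \<open>sin (k * t)\<close> over
  \<open>sin (k * l)\<close>. Pairing it with \<open>w\<close> gives the cosine of the scaled
  distance to a third vertex.\<close>

lemma great_arc_inner:
  assumes "k > 0" "sin (k * l) > 0"
  shows "sin (k * l) * (k\<^sup>2 * (great_arc k u v (k * l) t \<bullet> ((1 / k) *\<^sub>R w)))
    = sin (k * (l - t)) * (u \<bullet> w) + sin (k * t) * (v \<bullet> w)"
proof -
  have "k\<^sup>2 * (great_arc k u v (k * l) t \<bullet> ((1 / k) *\<^sub>R w))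
    = cos (k * t) * (u \<bullet> w) + sin (k * t) / sin (k * l) * (v \<bullet> w - cos (k * l) * (u \<bullet> w))"
    using assms(1) by (simp add: great_arc_def inner_add_left inner_diff_left power2_eq_square)
  then show ?thesis
    using assms(2) by (simp add: right_diff_distrib sin_diff field_simps)
qed

text \<open>On the sphere this is an equality, so it carries the whole comparison of a vertex with the
  opposite side without mentioning angles.\<close>

lemma CAT_space_vertex_comparison:
  fixes \<sigma> :: "real \<Rightarrow> 'a::metric_space" and y :: 'a
  assumes \<kappa>: "\<kappa> > 0" and k: "k = sqrt \<kappa>" and cat: "CAT_space \<kappa> TYPE('a)"
    and \<sigma>: "geodesic L \<sigma>" and L: "0 < L" and p: "p \<in> {0..L}"
    and per: "L + dist (\<sigma> 0) y + dist (\<sigma> L) y < 2 * pi / k"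
  shows "sin (k * (L - p)) * cos (k * dist (\<sigma> 0) y) + sin (k * p) * cos (k * dist (\<sigma> L) y)
    \<le> sin (k * L) * cos (k * dist (\<sigma> p) y)"
proof -
  have k0: "k > 0" "k * k = \<kappa>" using \<kappa> k by auto
  define b where "b = dist (\<sigma> 0) y"
  define a where "a = dist (\<sigma> L) y"
  have Ld: "dist (\<sigma> 0) (\<sigma> L) = L" using \<sigma> L by (auto simp: geodesic_in_def)
  have tri: "L \<le> a + b" "a \<le> b + L" "b \<le> a + L" "0 \<le> a" "0 \<le> b"
    using Ld dist_triangle2[of "\<sigma> 0" "\<sigma> L" y] dist_triangle3[of "\<sigma> L" y "\<sigma> 0"]
      dist_triangle[of "\<sigma> 0" y "\<sigma> L"] unfolding a_def b_def by (auto simp: dist_commute)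
  have per': "L + b + a < 2 * (pi / k)" using per by (simp add: a_def b_def)
  have lt: "L < pi / k" "a < pi / k" "b < pi / k" using per' tri by linarith+
  then have klt: "k * L < pi" "k * a < pi" "k * b < pi" using k0 by (auto simp: field_simps)
  have ex: "\<exists>l \<gamma>. geodesic l \<gamma> \<and> \<gamma> 0 = u \<and> \<gamma> l = v" if "dist u v < pi / k" for u v :: 'a
    using cat that unfolding CAT_space_def k by blast
  have ex': "\<exists>\<gamma>. geodesic (dist u v) \<gamma> \<and> \<gamma> 0 = u \<and> \<gamma> (dist u v) = v" if uv: "dist u v < pi / k"
    for u v :: 'a
  proof -
    obtain l \<gamma> where g: "geodesic l \<gamma>" "\<gamma> 0 = u" "\<gamma> l = v" using ex[OF uv] by blast
    then have "dist (\<gamma> 0) (\<gamma> l) = l" by (auto simp: geodesic_in_def)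
    then show ?thesis using g by auto
  qed
  obtain \<sigma>1 where s1: "geodesic a \<sigma>1" "\<sigma>1 0 = \<sigma> L" "\<sigma>1 a = y"
    using ex'[of "\<sigma> L" y] lt unfolding a_def by blast
  obtain \<sigma>2 where s2: "geodesic b \<sigma>2" "\<sigma>2 0 = y" "\<sigma>2 b = \<sigma> 0"
    using ex'[of y "\<sigma> 0"] lt unfolding b_def by (metis dist_commute)
  \<comment> \<open>The comparison triangle, scaled to the unit sphere: \<open>u\<close>,
    \<open>v\<close>, \<open>w\<close> stand for \<open>\<sigma> 0\<close>,
    \<open>\<sigma> L\<close> and \<open>y\<close>.\<close>
  obtain u v w :: "real^3" where uvw: "u \<bullet> u = 1" "v \<bullet> v = 1" "w \<bullet> w = 1"
    "u \<bullet> v = cos (k * L)" "v \<bullet> w = cos (k * a)" "u \<bullet> w = cos (k * b)"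
  proof (rule spherical_triangle_exists[of "k * a" "k * b" "k * L"])
    show "k * a \<le> k * b + k * L" "k * b \<le> k * a + k * L" "k * L \<le> k * a + k * b"
      using tri k0 by (simp_all flip: distrib_left)
    have "k * (a + b + L) \<le> k * (2 * (pi / k))" using per' k0 by (intro mult_left_mono) auto
    then show "k * a + k * b + k * L \<le> 2 * pi" using k0 by (simp add: algebra_simps)
  qed (use tri k0 L in auto)
  define l where "l i = (if i = 0 then L else if i = 1 then a else b)" for i :: nat
  define S where "S i = (if i = 0 then \<sigma> else if i = 1 then \<sigma>1 else \<sigma>2)" for i :: nat
  define S' where "S' i = (if i = 0 then great_arc k u v (k * L)
      else if i = 1 then great_arc k v w (k * a) else great_arc k w u (k * b))" for i :: nat
  have i3: "(\<forall>i<3. P i) \<longleftrightarrow> P 0 \<and> P (Suc 0) \<and> P (Suc (Suc 0))" for P :: "nat \<Rightarrow> bool"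
    by (auto simp: less_Suc_eq numeral_3_eq_3)
  have T: "geodesic_triangle_in UNIV dist l S"
    using \<sigma> s1 s2 unfolding geodesic_triangle_in_def i3 by (simp add: l_def S_def)
  have e: "great_arc k u v (k * L) L = (1 / k) *\<^sub>R v" "great_arc k v w (k * a) a = (1 / k) *\<^sub>R w"
    "great_arc k w u (k * b) b = (1 / k) *\<^sub>R u"
    using great_arc_end[of k] uvw tri klt L k0 by (auto simp: inner_commute)
  have T': "geodesic_triangle_in (model_surface \<kappa>) (model_dist \<kappa>) l S'"
    using geodesic_in_great_arc[OF \<kappa> k] uvw tri klt L e
    unfolding geodesic_triangle_in_def i3 by (simp add: l_def S'_def inner_commute)
  have "\<forall>i<3. \<forall>j<3. \<forall>s\<in>{0..l i}. \<forall>t\<in>{0..l j}. dist (S i s) (S j t) \<le> model_dist \<kappa> (S' i s) (S' j t)"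
  proof -
    have "l 0 + l 1 + l 2 < 2 * pi / sqrt \<kappa>" using per' by (simp add: l_def k)
    then show ?thesis using cat T T' unfolding CAT_space_def by blast
  qed
  then have "\<forall>s\<in>{0..l 0}. \<forall>t\<in>{0..l 1}. dist (S 0 s) (S 1 t) \<le> model_dist \<kappa> (S' 0 s) (S' 1 t)"
    by simp
  \<comment> \<open>Side 1 evaluated at its full length \<open>a\<close> is the vertex
    \<open>y\<close>.\<close>
  then have "dist (S 0 p) (S 1 a) \<le> model_dist \<kappa> (S' 0 p) (S' 1 a)"
    using p tri by (auto simp: l_def)
  then have le: "dist (\<sigma> p) y \<le> model_dist \<kappa> (great_arc k u v (k * L) p) ((1 / k) *\<^sub>R w)"
    using s1 e by (simp add: S_def S'_def)
  \<comment> \<open>\<open>I\<close> is the cosine of \<open>k\<close> times the comparison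
    distance; Cauchy-Schwarz puts it in the range where \<open>cos\<close> undoes
    \<open>arccos\<close>.\<close>
  define I where "I = k\<^sup>2 * (great_arc k u v (k * L) p \<bullet> ((1 / k) *\<^sub>R w))"
  have "great_arc k u v (k * L) p \<in> model_surface \<kappa>"
    using geodesic_in_great_arc[OF \<kappa> k uvw(1,2,4)] p L klt by (auto simp: geodesic_in_def)
  then have nrm: "norm (great_arc k u v (k * L) p) = 1 / k" by (simp add: model_surface_def k)
  have "norm w = 1" using uvw by (simp add: norm_eq_1)
  then have "\<bar>great_arc k u v (k * L) p \<bullet> ((1 / k) *\<^sub>R w)\<bar> \<le> (1 / k) * (1 / k)"
    using Cauchy_Schwarz_ineq2[of "great_arc k u v (k * L) p" "(1 / k) *\<^sub>R w"] nrm k0 by simp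
  then have "k\<^sup>2 * \<bar>great_arc k u v (k * L) p \<bullet> ((1 / k) *\<^sub>R w)\<bar> \<le> k\<^sup>2 * ((1 / k) * (1 / k))"
    by (intro mult_left_mono) auto
  moreover have "k\<^sup>2 * ((1 / k) * (1 / k)) = 1" using k0(1) by (simp add: power2_eq_square)
  ultimately have I1: "\<bar>I\<bar> \<le> 1" unfolding I_def abs_mult abs_power2 by linarith
  have "k * dist (\<sigma> p) y \<le> arccos I"
    using le k0 k by (simp add: model_dist_def I_def power2_eq_square field_simps)
  then have "cos (arccos I) \<le> cos (k * dist (\<sigma> p) y)"
    using k0 arccos_bounded[of I] I1 by (intro cos_monotone_0_pi_le) auto
  then have "I \<le> cos (k * dist (\<sigma> p) y)" using I1 by (simp add: cos_arccos_abs)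
  moreover have sp: "0 < sin (k * L)" using k0 L klt by (intro sin_gt_zero) auto
  ultimately have "sin (k * L) * I \<le> sin (k * L) * cos (k * dist (\<sigma> p) y)" by simp
  then show ?thesis
    unfolding I_def great_arc_inner[OF k0(1) sp] uvw a_def b_def .
qed

section \<open>Trigonometric inequalities\<close>

text \<open>The quotient \<open>sin t / t\<close> decreases, because the numerator
  \<open>t * cos t - sin t\<close> of its derivative starts at 0 and has derivative
  \<open>- t * sin t\<close>.\<close>

lemma sin_div_antimono:
  fixes \<theta> \<phi> :: real
  assumes "0 < \<theta>" "\<theta> \<le> \<phi>" "\<phi> \<le> pi"
  shows "\<theta> * sin \<phi> \<le> \<phi> * sin \<theta>"
proof -
  have c: "x * cos x \<le> sin x" if "0 \<le> x" "x \<le> pi" for x :: real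
  proof -
    have "sin 0 - 0 * cos 0 \<le> sin x - x * cos x"
    proof (rule DERIV_nonneg_imp_nondecreasing[OF that(1)])
      fix t assume t: "0 \<le> t" "t \<le> x"
      have "((\<lambda>x. sin x - x * cos x) has_real_derivative t * sin t) (at t)"
        by (auto intro!: derivative_eq_intros)
      moreover have "t * sin t \<ge> 0" using t that by (simp add: sin_ge_zero)
      ultimately show "\<exists>y. ((\<lambda>x. sin x - x * cos x) has_real_derivative y) (at t) \<and> 0 \<le> y" by blast
    qed
    then show ?thesis by simp
  qed
  have "sin \<phi> / \<phi> \<le> sin \<theta> / \<theta>"
  proof (rule DERIV_nonpos_imp_nonincreasing[OF assms(2)])
    fix t assume t: "\<theta> \<le> t" "t \<le> \<phi>"
    then have "((\<lambda>x. sin x / x) has_real_derivative (t * cos t - sin t) / (t * t)) (at t)"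
      using assms by (auto intro!: derivative_eq_intros simp: mult.commute)
    moreover have "(t * cos t - sin t) / (t * t) \<le> 0"
      using t assms c[of t] by (intro divide_nonpos_nonneg) auto
    ultimately show "\<exists>y. ((\<lambda>x. sin x / x) has_real_derivative y) (at t) \<and> y \<le> 0" by blast
  qed
  then show ?thesis using assms by (simp add: field_simps)
qed

text \<open>The tangent line inequality of the convex function \<open>u \<mapsto> (arccos u)\<^sup>2\<close> at \<open>u = cos \<theta>\<close>.\<close>

lemma arccos_square_tangent:
  fixes \<theta> \<phi> :: real
  assumes "0 < \<theta>" "\<theta> < pi" "0 \<le> \<phi>" "\<phi> \<le> pi"
  shows "\<theta>\<^sup>2 + 2 * \<theta> / sin \<theta> * (cos \<theta> - cos \<phi>) \<le> \<phi>\<^sup>2"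
proof -
  have s: "sin \<theta> > 0" using assms by (intro sin_gt_zero) auto
  \<comment> \<open>After multiplication by \<open>sin \<theta>\<close> the claim reads
    \<open>h \<theta> \<le> h \<phi>\<close>. The sign of the derivative of \<open>h\<close> is
    governed by the monotonicity of \<open>sin x / x\<close>, so \<open>h\<close> is smallest at
    \<open>\<theta>\<close>.\<close>
  define h where "h x = x\<^sup>2 * sin \<theta> + 2 * \<theta> * cos x" for x
  have D: "(h has_real_derivative 2 * (x * sin \<theta> - \<theta> * sin x)) (at x)" for x
    unfolding h_def by (auto intro!: derivative_eq_intros simp: algebra_simps)
  have "h \<theta> \<le> h \<phi>"
  proof (cases "\<theta> \<le> \<phi>")
    case True
    show ?thesis
    proof (rule DERIV_nonneg_imp_nondecreasing[OF True])
      fix x assume "\<theta> \<le> x" "x \<le> \<phi>"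
      then have "0 \<le> 2 * (x * sin \<theta> - \<theta> * sin x)"
        using sin_div_antimono[of \<theta> x] assms by simp
      then show "\<exists>y. (h has_real_derivative y) (at x) \<and> 0 \<le> y" using D by blast
    qed
  next
    case False
    then have "\<phi> \<le> \<theta>" by simp
    then show ?thesis
    proof (rule DERIV_nonpos_imp_nonincreasing)
      fix x assume x: "\<phi> \<le> x" "x \<le> \<theta>"
      have "x * sin \<theta> \<le> \<theta> * sin x"
        using sin_div_antimono[of x \<theta>] assms x by (cases "x = 0") (auto simp: mult.commute)
      then show "\<exists>y. (h has_real_derivative y) (at x) \<and> y \<le> 0"
        using D by (intro exI[of _ "2 * (x * sin \<theta> - \<theta> * sin x)"]) auto
    qed
  qed
  then show ?thesis using s by (simp add: h_def field_simps)
qed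

text \<open>This is the final distance comparison, scaled by \<open>k\<close>: \<open>S\<close>,
  \<open>E\<close>, \<open>\<Delta>\<close> stand for the distances from \<open>x\<close> to
  \<open>w\<close>, from \<open>x\<close> to \<open>y\<close> and from \<open>w\<close> to
  \<open>y\<close>, \<open>G\<close> for the increment of \<open>f\<close> from \<open>x\<close> to
  \<open>y\<close>, and \<open>c\<close> for the height of an epigraph point above
  \<open>f x\<close>. The tangent inequality turns the cosine bound into a lower bound on the square
  of \<open>\<Delta>\<close> that is flat up to a gain of order \<open>E\<^sup>2\<close>.\<close>

lemma spherical_subgradient_estimate:
  fixes S E \<Delta> G m :: real
  assumes S: "0 < S" "S \<le> 1 / 2" and E: "0 < E" "E \<le> 1" and \<Delta>: "0 \<le> \<Delta>" "\<Delta> \<le> pi"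
    and m: "0 < m" and H: "S / m \<le> 1"
    and le: "cos \<Delta> \<le> cos S * cos E + sin S * (G * (sin E / E) / m)"
    and c: "G \<le> c"
  shows "S\<^sup>2 + (S / m)\<^sup>2 < \<Delta>\<^sup>2 + (S / m + c)\<^sup>2"
proof -
  define H where "H = S / m"
  define q where "q = sin E / E"
  have H01: "0 < H" "H \<le> 1" using S m H by (auto simp: H_def)
  have sb: "x - x ^ 3 / 6 \<le> sin x" if "0 < x" for x :: real
    using Maclaurin_sin_bound[of x 3] that
    by (simp add: sin_coeff_def eval_nat_numeral fact_numeral abs_if split: if_splits)
  have "E\<^sup>2 \<le> 1" using E by (simp add: power_le_one)
  have q: "1 - E\<^sup>2 / 6 \<le> q" "q \<le> 1"
    using sb[of E] sin_x_le_x[of E] E by (auto simp: q_def field_simps power2_eq_square power3_eq_cube)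
  have "sin S > 0" using S pi_gt3 by (intro sin_gt_zero) auto
  \<comment> \<open>The constants are chosen so that \<open>2 * (7 / 8) * (2 / 5)\<close> exceeds
    \<open>1 / 2\<close>: the gain \<open>E\<^sup>2 / 2\<close> then outweighs the error
    \<open>E\<^sup>2 / 3\<close> caused below by \<open>q\<close>.\<close>
  have "cos S \<ge> 7 / 8"
  proof -
    have "(sin (S / 2))\<^sup>2 \<le> (1 / 4)\<^sup>2"
      using sin_x_le_x[of "S / 2"] sin_ge_zero[of "S / 2"] S pi_gt3 by (intro power_mono) auto
    then show ?thesis using cos_double_sin[of "S / 2"] by (simp add: power2_eq_square)
  qed
  have "23 / 48 * E \<le> sin (E / 2)"
  proof -
    have "(E / 2) ^ 3 / 6 = E * (E\<^sup>2 / 48)" by (simp add: power2_eq_square power3_eq_cube)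
    also have "\<dots> \<le> E * (1 / 48)" using \<open>E\<^sup>2 \<le> 1\<close> E by (intro mult_left_mono) auto
    finally show ?thesis using sb[of "E / 2"] E by simp
  qed
  then have "(23 / 48 * E)\<^sup>2 \<le> (sin (E / 2))\<^sup>2" using E by (intro power_mono) auto
  then have "(23 / 48)\<^sup>2 * E\<^sup>2 \<le> (sin (E / 2))\<^sup>2" unfolding power_mult_distrib .
  then have "2 * (23 / 48)\<^sup>2 * E\<^sup>2 \<le> 1 - cos E"
    using cos_double_sin[of "E / 2"] by simp
  moreover have "2 / 5 * E\<^sup>2 \<le> 2 * (23 / 48)\<^sup>2 * E\<^sup>2"
    by (intro mult_right_mono) (simp_all add: power2_eq_square)
  ultimately have cE: "2 / 5 * E\<^sup>2 \<le> 1 - cos E" by linarith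
  have SsS: "1 \<le> S / sin S" using sin_x_le_x[of S] S \<open>sin S > 0\<close> by simp
  then have SC: "7 / 8 \<le> S / sin S * cos S"
    using mult_mono[of 1 "S / sin S" "7 / 8" "cos S"] \<open>cos S \<ge> 7 / 8\<close> by simp
  have "7 / 8 * (2 / 5 * E\<^sup>2) \<le> S / sin S * cos S * (1 - cos E)"
    by (rule mult_mono[OF SC cE]) (use SC in linarith, simp)
  then have g1: "E\<^sup>2 / 2 < 2 * (S / sin S * cos S * (1 - cos E))"
    using zero_less_power[OF E(1), of 2] by linarith
  have "S\<^sup>2 + 2 * S / sin S * (cos S - (cos S * cos E + sin S * (G * q / m)))
      \<le> S\<^sup>2 + 2 * S / sin S * (cos S - cos \<Delta>)"
    using le S \<open>sin S > 0\<close> unfolding q_def by (intro add_left_mono mult_left_mono) auto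
  also have "\<dots> \<le> \<Delta>\<^sup>2" using S \<Delta> pi_gt3 by (intro arccos_square_tangent) auto
  also have "S\<^sup>2 + 2 * S / sin S * (cos S - (cos S * cos E + sin S * (G * q / m)))
    = S\<^sup>2 + 2 * (S / sin S * cos S * (1 - cos E)) - 2 * H * G * q"
    using \<open>sin S > 0\<close> m by (simp add: H_def field_simps)
  finally have key: "S\<^sup>2 + E\<^sup>2 / 2 - 2 * H * G * q < \<Delta>\<^sup>2" using g1 by linarith
  \<comment> \<open>If \<open>0 \<le> H + G\<close>, then \<open>c\<close> may be lowered to
    \<open>G\<close>, and the mixed term \<open>2 * H * G\<close> of the square cancels
    \<open>2 * H * G * q\<close> up to \<open>E\<^sup>2 / 3\<close>. Otherwise
    \<open>G < - H\<close>, and \<open>- 2 * H * G * q\<close> alone is at least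
    \<open>H\<^sup>2\<close>.\<close>
  have "S\<^sup>2 + H\<^sup>2 < \<Delta>\<^sup>2 + (H + c)\<^sup>2"
  proof (cases "0 \<le> H + G")
    case True
    then have "(H + G)\<^sup>2 \<le> (H + c)\<^sup>2" using c by (intro power_mono) auto
    moreover have "2 * H * G * q \<le> 2 * H * G + E\<^sup>2 / 3"
    proof (cases "0 \<le> G")
      case True
      then have "2 * H * G * q \<le> 2 * H * G * 1" using q H01 by (intro mult_left_mono) auto
      then show ?thesis using zero_le_power2[of E] by linarith
    next
      case False
      have "H * (- G) \<le> 1 * 1" using True False H01 by (intro mult_mono) auto
      then have "H * (- G) * (1 - q) \<le> 1 * (E\<^sup>2 / 6)"
        using q False H01 by (intro mult_mono) (auto simp: mult_nonneg_nonpos)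
      then show ?thesis by (simp add: algebra_simps)
    qed
    moreover have "(H + G)\<^sup>2 = H\<^sup>2 + 2 * H * G + G\<^sup>2" by (simp add: power2_sum)
    ultimately show ?thesis using key zero_le_power2[of G] E zero_less_power[of E 2] by linarith
  next
    case False
    have "1 / 2 \<le> q" using q \<open>E\<^sup>2 \<le> 1\<close> by simp
    then have "H * (- G) * q \<ge> H * H * (1 / 2)"
      using False H01 by (intro mult_mono) (auto simp: mult_nonneg_nonpos)
    then have "H\<^sup>2 \<le> - 2 * H * G * q" by (simp add: power2_eq_square)
    then show ?thesis using key E zero_le_power2[of "H + c"] zero_less_power[of E 2] by linarith
  qed
  then show ?thesis by (simp add: H_def)
qed

section \<open>Proximal points and steepest descent\<close>

lemma CAT_space_geodesic:
  fixes y z :: "'a::metric_space"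
  assumes "CAT_space \<kappa> TYPE('a)" "dist y z < pi / sqrt \<kappa>"
  obtains \<gamma> where "geodesic (dist y z) \<gamma>" "\<gamma> 0 = y" "\<gamma> (dist y z) = z"
proof -
  obtain l \<gamma> where g: "geodesic l \<gamma>" "\<gamma> 0 = y" "\<gamma> l = z"
    using assms unfolding CAT_space_def by blast
  then have "dist y z = l" by (auto simp: geodesic_in_def)
  then show thesis using that g by blast
qed

lemma geodesic_in_restrict:
  "geodesic_in M d l \<gamma> \<Longrightarrow> 0 \<le> l' \<Longrightarrow> l' \<le> l \<Longrightarrow> geodesic_in M d l' \<gamma>"
  by (auto simp: geodesic_in_def)

text \<open>Comparing the minimum with the value at \<open>x\<close> bounds the displacement from
  above. Comparing it with \<open>y\<close>, whose distance \<open>c * \<tau>\<close> minimises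
  \<open>- c * t + t\<^sup>2 / (2 * \<tau>)\<close>, forces \<open>F\<close> to drop by at least
  \<open>c\<^sup>2 * \<tau> / 2\<close>, and the Lipschitz bound turns this drop into a displacement
  of order \<open>\<tau>\<close>.\<close>

lemma proximal_point_exists:
  fixes F :: "'a::metric_space \<Rightarrow> real"
  assumes "compact (cball x \<rho>)" and lip: "L-lipschitz_on (cball x \<rho>) F" and "0 < L"
    and lam: "0 < \<tau>" "2 * L * \<tau> < \<rho>" and c: "0 < c" "c * \<tau> \<le> \<rho>"
    and desc: "dist x y = c * \<tau>" "F y \<le> F x - c * (c * \<tau>)"
  obtains z where "dist x z < \<rho>" "dist x z \<le> 2 * L * \<tau>" "c\<^sup>2 / (2 * L) \<le> dist x z / \<tau>"
    "\<And>q. q \<in> cball x \<rho> \<Longrightarrow> F z + (dist x z)\<^sup>2 / (2 * \<tau>) \<le> F q + (dist x q)\<^sup>2 / (2 * \<tau>)"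
proof -
  have \<rho>: "0 < \<rho>" using lam \<open>0 < L\<close> by (smt (verit) mult_pos_pos)
  have "continuous_on (cball x \<rho>) F" by (rule lipschitz_on_continuous_on[OF lip])
  then have cont: "continuous_on (cball x \<rho>) (\<lambda>q. F q + (dist x q)\<^sup>2 / (2 * \<tau>))"
    using lam by (intro continuous_intros) auto
  obtain z where z: "z \<in> cball x \<rho>"
    and min: "\<And>q. q \<in> cball x \<rho> \<Longrightarrow> F z + (dist x z)\<^sup>2 / (2 * \<tau>) \<le> F q + (dist x q)\<^sup>2 / (2 * \<tau>)"
    using continuous_attains_inf[OF assms(1) _ cont] \<rho> by auto
  define s where "s = dist x z"
  have "\<bar>F x - F z\<bar> \<le> L * s"
    using lipschitz_onD[OF lip, of x z] z \<rho> by (simp add: dist_real_def s_def)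
  then have up: "F x - F z \<le> L * s" by simp
  have "s\<^sup>2 / (2 * \<tau>) \<le> L * s" using min[of x] up \<rho> by (simp add: s_def)
  then have "s * s \<le> (2 * L * \<tau>) * s" using lam by (simp add: field_simps power2_eq_square)
  then have s1: "s \<le> 2 * L * \<tau>"
    using lam \<open>0 < L\<close> by (cases "s = 0") (auto simp: s_def)
  have "F z + s\<^sup>2 / (2 * \<tau>) \<le> F y + (c * \<tau>)\<^sup>2 / (2 * \<tau>)"
    using min[of y] c desc by (simp add: s_def)
  also have "\<dots> \<le> F x - c * (c * \<tau>) + (c * \<tau>)\<^sup>2 / (2 * \<tau>)" using desc by simp
  also have "\<dots> = F x - c\<^sup>2 * \<tau> / 2" using lam by (simp add: field_simps power2_eq_square)
  finally have "F z + s\<^sup>2 / (2 * \<tau>) \<le> F x - c\<^sup>2 * \<tau> / 2" .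
  moreover have "0 \<le> s\<^sup>2 / (2 * \<tau>)" using lam by simp
  ultimately have "c\<^sup>2 * \<tau> / 2 \<le> L * s" using up by linarith
  then have "c\<^sup>2 / (2 * L) \<le> s / \<tau>" using lam \<open>0 < L\<close> by (simp add: field_simps)
  then show thesis using that[of z] min s1 lam by (simp add: s_def)
qed

text \<open>Minimality bounds the increase of \<open>F\<close> along \<open>\<eta>\<close> from
  below by the decrease of the squared distance to \<open>x\<close>, which the CAT inequality
  controls; dividing by \<open>e\<close> and letting \<open>e\<close> tend to 0 gives the claim. By
  the spherical law of cosines the fraction on the left is \<open>sin (k * l)\<close> times the
  cosine of the comparison angle at \<open>z\<close>.\<close>

lemma proximal_point_first_variation:
  fixes \<eta> :: "real \<Rightarrow> 'a::metric_space" and F :: "'a \<Rightarrow> real"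
  assumes \<kappa>: "\<kappa> > 0" and k: "k = sqrt \<kappa>" and cat: "CAT_space \<kappa> TYPE('a)"
    and \<eta>: "geodesic l \<eta>" "\<eta> 0 = z" "\<eta> l = y" and l: "0 < l"
    and s: "s = dist x z" "0 < s" "k * s < pi" and lam: "0 < \<tau>"
    and per: "l + s + dist x y < 2 * pi / k"
    and e0: "0 < e0" "e0 \<le> l"
    and conv: "\<And>e. e \<in> {0..e0} \<Longrightarrow> F (\<eta> e) \<le> (1 - e / l) * F z + e / l * F y"
    and min: "\<And>e. e \<in> {0..e0} \<Longrightarrow> F z + s\<^sup>2 / (2 * \<tau>) \<le> F (\<eta> e) + (dist x (\<eta> e))\<^sup>2 / (2 * \<tau>)"
  shows "s / \<tau> * ((cos (k * dist x y) - cos (k * s) * cos (k * l)) / sin (k * s))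
    \<le> (F y - F z) * (sin (k * l) / l)"
proof -
  have k0: "k > 0" using \<kappa> k by auto
  have dl: "dist z y = l" using \<eta> l by (auto simp: geodesic_in_def)
  have "l \<le> s + dist x y" using dl s dist_triangle3[of z y x] by simp
  then have "l < pi / k" using per by simp
  then have kl: "k * l < pi" using k0 by (simp add: field_simps)
  have sl: "sin (k * l) > 0" using kl k0 l by (intro sin_gt_zero) auto
  have ss: "sin (k * s) > 0" using s k0 by (intro sin_gt_zero) auto
  define d where "d e = dist x (\<eta> e)" for e
  \<comment> \<open>\<open>\<phi> e\<close> is the cosine of \<open>k\<close> times the distance
    between the comparison points of \<open>x\<close> and \<open>\<eta> e\<close>; \<open>A\<close>
    is its derivative at 0.\<close>
  define \<phi> where "\<phi> e = (sin (k * (l - e)) * cos (k * s) + sin (k * e) * cos (k * dist x y)) / sin (k * l)" for e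
  define A where "A = k * (cos (k * dist x y) - cos (k * s) * cos (k * l)) / sin (k * l)"
  have \<phi>0: "\<phi> 0 = cos (k * s)" using sl by (simp add: \<phi>_def)
  have le: "\<phi> e \<le> cos (k * d e)" if "e \<in> {0..l}" for e
  proof -
    have "sin (k * (l - e)) * cos (k * dist (\<eta> 0) x) + sin (k * e) * cos (k * dist (\<eta> l) x)
      \<le> sin (k * l) * cos (k * dist (\<eta> e) x)"
      using per s \<eta> by (intro CAT_space_vertex_comparison[OF \<kappa> k cat \<eta>(1) l that]) (simp add: dist_commute)
    then show ?thesis using sl \<eta> s unfolding \<phi>_def d_def by (simp add: dist_commute field_simps)
  qed
  have ev: "eventually (\<lambda>e. 0 < e \<and> e \<le> e0) (at_right 0)"
    using e0 by (auto simp: eventually_at_right_field intro!: exI[of _ e0])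
  have "((\<lambda>e. d e - s) \<longlongrightarrow> 0) (at_right 0)"
  proof (rule Lim_null_comparison[where g = "\<lambda>e. e"])
    show "eventually (\<lambda>e. norm (d e - s) \<le> e) (at_right 0)"
      using ev
    proof eventually_elim
      case (elim e)
      then have "dist (\<eta> e) (\<eta> 0) = e" using \<eta>(1) e0 by (auto simp: geodesic_in_def)
      then show ?case
        using abs_dist_diff_le[of "\<eta> e" x z] \<eta>(2) by (simp add: d_def s dist_commute)
    qed
  qed (auto intro: tendsto_eq_intros)
  then have dl: "(d \<longlongrightarrow> s) (at_right 0)" by (simp add: Lim_null[of d])
  have "(\<phi> has_real_derivative A) (at 0)"
    unfolding \<phi>_def A_def using sl by (auto intro!: derivative_eq_intros simp: field_simps)
  then have "((\<lambda>e. (\<phi> e - \<phi> 0) / e) \<longlongrightarrow> A) (at 0)"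
    by (simp add: has_field_derivative_iff)
  then have dq: "((\<lambda>e. (\<phi> e - \<phi> 0) / e) \<longlongrightarrow> A) (at_right 0)"
    by (rule tendsto_mono[rotated]) (simp add: at_within_le_at)
  \<comment> \<open>An upper bound for the square of \<open>d e\<close> calls for the tangent
    inequality based at \<open>d e\<close>, not at \<open>s\<close>. The slope therefore varies with
    \<open>e\<close>, and \<open>d e\<close> tending to \<open>s\<close> is used for its
    limit.\<close>
  have lim: "((\<lambda>e. 1 / (2 * \<tau> * k\<^sup>2) * (2 * (k * d e) / sin (k * d e)) * ((\<phi> e - \<phi> 0) / e)) \<longlongrightarrow>
      1 / (2 * \<tau> * k\<^sup>2) * (2 * (k * s) / sin (k * s)) * A) (at_right 0)"
    using ss by (intro tendsto_intros dl dq) auto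
  have "eventually (\<lambda>e. 0 < d e \<and> d e < pi / k) (at_right 0)"
    using s k0 by (intro eventually_conj order_tendstoD[OF dl]) (auto simp: field_simps)
  then have "eventually (\<lambda>e. 1 / (2 * \<tau> * k\<^sup>2) * (2 * (k * d e) / sin (k * d e)) * ((\<phi> e - \<phi> 0) / e)
      \<le> (F y - F z) / l) (at_right 0)"
    using ev
  proof eventually_elim
    case (elim e)
    then have kd: "0 < k * d e" "k * d e < pi" using k0 by (auto simp: field_simps)
    have sd: "sin (k * d e) > 0" using kd by (intro sin_gt_zero)
    have "2 * (k * d e) / sin (k * d e) * (\<phi> e - \<phi> 0)
        \<le> 2 * (k * d e) / sin (k * d e) * (cos (k * d e) - cos (k * s))"
      using sd kd le[of e] elim e0 \<phi>0 by (intro mult_left_mono) auto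
    also have "\<dots> \<le> (k * s)\<^sup>2 - (k * d e)\<^sup>2"
      using arccos_square_tangent[OF kd, of "k * s"] s k0 by simp
    also have "\<dots> = (2 * \<tau> * k\<^sup>2) * (s\<^sup>2 / (2 * \<tau>) - (d e)\<^sup>2 / (2 * \<tau>))"
      using lam by (simp add: field_simps power_mult_distrib)
    also have "\<dots> \<le> (2 * \<tau> * k\<^sup>2) * (F (\<eta> e) - F z)"
      using min[of e] elim lam unfolding d_def by (intro mult_left_mono) auto
    also have "\<dots> \<le> (2 * \<tau> * k\<^sup>2) * (e / l * (F y - F z))"
    proof (rule mult_left_mono)
      have "F (\<eta> e) \<le> (1 - e / l) * F z + e / l * F y" using conv[of e] elim by simp
      then show "F (\<eta> e) - F z \<le> e / l * (F y - F z)" by (simp add: algebra_simps)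
    qed (use lam in auto)
    finally have "2 * (k * d e) / sin (k * d e) * (\<phi> e - \<phi> 0) / ((2 * \<tau> * k\<^sup>2) * e)
        \<le> (2 * \<tau> * k\<^sup>2) * (e / l * (F y - F z)) / ((2 * \<tau> * k\<^sup>2) * e)"
      using lam k0 elim by (intro divide_right_mono) auto
    also have "\<dots> = (F y - F z) / l" using lam k0 elim by simp
    finally have le: "2 * (k * d e) / sin (k * d e) * (\<phi> e - \<phi> 0) / ((2 * \<tau> * k\<^sup>2) * e)
        \<le> (F y - F z) / l" .
    have eq: "1 / a * P * (Y / e) = P * Y / (a * e)" for a P Y :: real by simp
    show ?case unfolding eq by (rule le)
  qed
  then have "1 / (2 * \<tau> * k\<^sup>2) * (2 * (k * s) / sin (k * s)) * A \<le> (F y - F z) / l"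
    by (intro tendsto_upperbound[OF lim]) auto
  then have "1 / (2 * \<tau> * k\<^sup>2) * (2 * (k * s) / sin (k * s)) * A * sin (k * l) \<le> (F y - F z) / l * sin (k * l)"
    using sl by (intro mult_right_mono) auto
  moreover have "1 / (2 * \<tau> * k\<^sup>2) * (2 * (k * s) / sin (k * s)) * A * sin (k * l)
    = s / \<tau> * ((cos (k * dist x y) - cos (k * s) * cos (k * l)) / sin (k * s))"
    using sl k0 ss lam by (simp add: A_def power2_eq_square)
  ultimately show ?thesis by simp
qed

text \<open>The estimate before the passage to the limit in \<open>\<tau>\<close>. The first
  variation bounds the comparison angle at \<open>z\<close> in the triangle of \<open>z\<close>,
  \<open>x\<close>, \<open>y\<close>; vertex comparison in the triangle of \<open>z\<close>,
  \<open>\<eta> (s + s')\<close>, \<open>y\<close>, which has \<open>x\<close> on a side, carries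
  the bound to the far end.\<close>

lemma steepest_ascent_point_approx:
  fixes F :: "'a::metric_space \<Rightarrow> real"
  assumes \<kappa>: "\<kappa> > 0" and k: "k = sqrt \<kappa>" and cat: "CAT_space \<kappa> TYPE('a)"
    and \<rho>: "k * \<rho> < pi / 4"
    and conv: "\<And>\<eta> l e. \<lbrakk>geodesic l \<eta>; 0 < l; \<eta> 0 \<in> cball x \<rho>; \<eta> l \<in> cball x \<rho>; e \<in> {0..l};
        \<eta> e \<in> cball x \<rho>\<rbrakk> \<Longrightarrow> F (\<eta> e) \<le> (1 - e / l) * F (\<eta> 0) + e / l * F (\<eta> l)"
    and z: "dist x z < \<rho>" "z \<noteq> x"
    and min: "\<And>q. q \<in> cball x \<rho> \<Longrightarrow> F z + (dist x z)\<^sup>2 / (2 * \<tau>) \<le> F q + (dist x q)\<^sup>2 / (2 * \<tau>)"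
    and lam: "0 < \<tau>" and s: "s = dist x z"
    and \<eta>: "geodesic (s + s') \<eta>" "\<eta> 0 = z" "\<eta> s = x" and s': "0 < s'" "s' < \<rho>"
    and y: "y \<in> cball x \<rho>" "y \<noteq> z"
  shows "cos (k * dist (\<eta> (s + s')) y) \<le> cos (k * s') * cos (k * dist x y)
    + sin (k * s') * (cos (k * s) * ((F y - F z) * (sin (k * dist z y) / dist z y) / (s / \<tau>))
      - sin (k * s) * cos (k * dist z y))"
proof -
  have k0: "k > 0" using \<kappa> k by auto
  define l where "l = dist z y"
  define w where "w = \<eta> (s + s')"
  have s0: "0 < s" "s < \<rho>" using z s by auto
  have \<rho>': "\<rho> < pi / k / 4" using \<rho> k0 by (simp add: field_simps)
  have ks: "k * s < pi / 2" "k * s' < pi / 2"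
    using \<rho> s0 s' k0 mult_strict_left_mono[of s \<rho> k] mult_strict_left_mono[of s' \<rho> k] pi_gt_zero by linarith+
  have "dist (\<eta> s) (\<eta> (s + s')) = \<bar>s - (s + s')\<bar>"
    using \<eta>(1) s0 s' unfolding geodesic_in_def by simp
  then have xw: "dist x w = s'" using \<eta>(3) s' by (simp add: w_def)
  have D: "dist x y \<le> \<rho>" using y by simp
  have l: "0 < l" "l < 2 * \<rho>" using y z D dist_triangle3[of z y x] by (auto simp: l_def)
  have wy: "dist w y < 2 * \<rho>" using xw s' D dist_triangle3[of w y x] by simp
  have "l < pi / sqrt \<kappa>" using l \<rho>' k0 pi_gt_zero divide_pos_pos[of pi k] by (simp flip: k)
  then obtain \<gamma> where \<gamma>: "geodesic l \<gamma>" "\<gamma> 0 = z" "\<gamma> l = y"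
    using CAT_space_geodesic[OF cat, of z y] unfolding l_def by blast
  \<comment> \<open>Up to distance \<open>\<rho> - s\<close> from \<open>z\<close> the triangle
    inequality keeps \<open>\<gamma>\<close> in the ball, where minimality and convexity of
    \<open>F\<close> are available.\<close>
  define e0 where "e0 = min l (\<rho> - s)"
  have e0: "0 < e0" "e0 \<le> l" using l s0 by (auto simp: e0_def)
  have inb: "\<gamma> e \<in> cball x \<rho>" if "e \<in> {0..e0}" for e
  proof -
    have "dist z (\<gamma> e) = e" using \<gamma> that e0 by (auto simp: geodesic_in_def)
    then show ?thesis using that dist_triangle[of x "\<gamma> e" z] s by (simp add: e0_def)
  qed
  have var: "s / \<tau> * ((cos (k * dist x y) - cos (k * s) * cos (k * l)) / sin (k * s))
    \<le> (F y - F z) * (sin (k * l) / l)"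
  proof (rule proximal_point_first_variation[OF \<kappa> k cat \<gamma> l(1) s s0(1) _ lam _ e0])
    show "k * s < pi" using ks pi_gt_zero by linarith
    have "l + s + dist x y < 4 * (pi / k / 4)" using l s0 D \<rho>' by linarith
    also have "\<dots> < 2 * pi / k" using k0 by (simp add: field_simps)
    finally show "l + s + dist x y < 2 * pi / k" .
    show "F (\<gamma> e) \<le> (1 - e / l) * F z + e / l * F y" if "e \<in> {0..e0}" for e
      using conv[OF \<gamma>(1) l(1) _ _ _ inb[OF that]] \<gamma> z y that e0 by auto
    show "F z + s\<^sup>2 / (2 * \<tau>) \<le> F (\<gamma> e) + (dist x (\<gamma> e))\<^sup>2 / (2 * \<tau>)" if "e \<in> {0..e0}" for e
      using min[OF inb[OF that]] by (simp add: s)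
  qed
  define B where "B = (cos (k * dist x y) - cos (k * s) * cos (k * l)) / sin (k * s)"
  have B: "B \<le> (F y - F z) * (sin (k * l) / l) / (s / \<tau>)"
    using var s0 lam unfolding B_def[symmetric] by (subst pos_le_divide_eq) (auto simp: mult.commute)
  have "0 < k * s" "0 < k * s'" using s0 s' k0 by auto
  then have ss: "sin (k * s) > 0" "cos (k * s) > 0" "sin (k * s') > 0"
    using ks by (simp_all only: sin_gt_zero2 cos_gt_zero)
  have "sin (k * (s + s' - s)) * cos (k * dist (\<eta> 0) y) + sin (k * s) * cos (k * dist (\<eta> (s + s')) y)
    \<le> sin (k * (s + s')) * cos (k * dist (\<eta> s) y)"
  proof (rule CAT_space_vertex_comparison[OF \<kappa> k cat \<eta>(1)])
    have "s + s' + l + dist w y < 6 * (pi / k / 4)" using l s0 s' wy \<rho>' by linarith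
    also have "\<dots> < 2 * pi / k" using k0 by (simp add: field_simps)
    finally show "s + s' + dist (\<eta> 0) y + dist (\<eta> (s + s')) y < 2 * pi / k"
      using \<eta> by (simp add: l_def w_def)
  qed (use s0 s' in auto)
  then have "sin (k * s) * cos (k * dist w y)
    \<le> sin (k * s) * (cos (k * s') * cos (k * dist x y))
      + sin (k * s') * (cos (k * s) * cos (k * dist x y) - cos (k * l))"
    using \<eta>(2,3) by (simp add: w_def l_def distrib_left sin_add) (simp add: algebra_simps)
  \<comment> \<open>Expressing \<open>cos (k * dist x y)\<close> through \<open>B\<close> extracts a
    factor \<open>sin (k * s)\<close>. Cancelling it leaves a bound that survives when
    \<open>s\<close> tends to 0.\<close>
  also have "cos (k * s) * cos (k * dist x y) - cos (k * l)
    = sin (k * s) * (cos (k * s) * B - sin (k * s) * cos (k * l))"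
  proof -
    have "sin (k * s) * B = cos (k * dist x y) - cos (k * s) * cos (k * l)"
      using ss by (simp add: B_def)
    then have "cos (k * s) * (sin (k * s) * B) - (sin (k * s))\<^sup>2 * cos (k * l)
      = cos (k * s) * cos (k * dist x y) - cos (k * l)"
      unfolding sin_squared_eq by (simp only:) (simp add: algebra_simps power2_eq_square)
    then show ?thesis by (simp add: algebra_simps power2_eq_square)
  qed
  finally have "sin (k * s) * cos (k * dist w y) \<le> sin (k * s) * (cos (k * s') * cos (k * dist x y)
      + sin (k * s') * (cos (k * s) * B - sin (k * s) * cos (k * l)))"
    by (simp add: algebra_simps)
  then have "cos (k * dist w y) \<le> cos (k * s') * cos (k * dist x y)
      + sin (k * s') * (cos (k * s) * B - sin (k * s) * cos (k * l))"
    using ss by simp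
  also have "\<dots> \<le> cos (k * s') * cos (k * dist x y)
      + sin (k * s') * (cos (k * s) * ((F y - F z) * (sin (k * l) / l) / (s / \<tau>)) - sin (k * s) * cos (k * l))"
    by (intro add_left_mono mult_left_mono diff_right_mono B less_imp_le[OF ss(2)] less_imp_le[OF ss(3)])
  finally show ?thesis by (simp add: w_def l_def)
qed

text \<open>The point \<open>w\<close> lies on a backward extension of a direction of steepest descent of \<open>F\<close> at \<open>x\<close>, and
  \<open>m\<close> is the rate of that descent; the inequality bounds the cosine of the spherical comparison angle at \<open>x\<close>
  between \<open>w\<close> and \<open>y\<close> by the difference quotient of \<open>F\<close>, divided by \<open>m\<close>.\<close>

lemma steepest_ascent_point_exists:
  fixes F :: "'a::metric_space \<Rightarrow> real"
  assumes \<kappa>: "\<kappa> > 0" and k: "k = sqrt \<kappa>" and cat: "CAT_space \<kappa> TYPE('a)"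
    and \<rho>: "0 < \<rho>" "k * \<rho> < pi / 4" and cpt: "compact (cball x \<rho>)"
    and lip: "L-lipschitz_on (cball x \<rho>) F" and L: "0 < L"
    and conv: "\<And>\<eta> l e. \<lbrakk>geodesic l \<eta>; 0 < l; \<eta> 0 \<in> cball x \<rho>; \<eta> l \<in> cball x \<rho>; e \<in> {0..l};
        \<eta> e \<in> cball x \<rho>\<rbrakk> \<Longrightarrow> F (\<eta> e) \<le> (1 - e / l) * F (\<eta> 0) + e / l * F (\<eta> l)"
    and ext: "geodesic_extension_around x R" "2 * \<rho> \<le> R"
    and desc: "0 < c" "0 < T" "\<And>t. \<lbrakk>0 < t; t < T\<rbrakk> \<Longrightarrow> \<exists>y. dist x y = t \<and> F y \<le> F x - c * t"
  obtains m where "0 < m"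
    "\<And>s. \<lbrakk>0 < s; s < \<rho>\<rbrakk> \<Longrightarrow> \<exists>w. dist x w = s \<and> (\<forall>y\<in>cball x \<rho> - {x}.
      cos (k * dist w y) \<le> cos (k * s) * cos (k * dist x y)
        + sin (k * s) * ((F y - F x) * (sin (k * dist x y) / dist x y) / m))"
proof -
  have k0: "k > 0" using \<kappa> k by auto
  \<comment> \<open>The three bounds keep the proximal point inside the open ball, the descent point
    at distance \<open>c * \<tau> n\<close> inside the closed ball, and that distance below
    \<open>T\<close>.\<close>
  define \<tau>0 where "\<tau>0 = min (\<rho> / (4 * L)) (min (\<rho> / (2 * c)) (T / (2 * c)))"
  have "0 < \<tau>0" using \<rho> L desc by (simp add: \<tau>0_def)
  define \<tau> where "\<tau> n = \<tau>0 / real (Suc n)" for n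
  have \<tau>: "0 < \<tau> n" "\<tau> n \<le> \<tau>0" for n
    using \<open>0 < \<tau>0\<close> by (auto simp: \<tau>_def divide_le_eq mult_le_cancel_left1)
  have "\<tau> \<longlonglongrightarrow> 0"
    unfolding \<tau>_def by (intro real_tendsto_divide_at_top[OF tendsto_const])
      (rule filterlim_compose[OF filterlim_real_sequentially filterlim_Suc])
  have "\<exists>z. dist x z < \<rho> \<and> dist x z \<le> 2 * L * \<tau> n \<and> c\<^sup>2 / (2 * L) \<le> dist x z / \<tau> n \<and>
    (\<forall>q\<in>cball x \<rho>. F z + (dist x z)\<^sup>2 / (2 * \<tau> n) \<le> F q + (dist x q)\<^sup>2 / (2 * \<tau> n))" for n
  proof -
    have \<tau>n: "\<tau> n \<le> \<rho> / (4 * L)" "\<tau> n \<le> \<rho> / (2 * c)" "\<tau> n \<le> T / (2 * c)"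
      using \<tau>(2)[of n] unfolding \<tau>0_def by auto
    then have b: "4 * L * \<tau> n \<le> \<rho>" "2 * (c * \<tau> n) \<le> \<rho>" "2 * (c * \<tau> n) \<le> T"
      using L desc by (simp_all add: field_simps)
    have ct: "0 < c * \<tau> n" using desc \<tau>(1)[of n] by simp
    then obtain y where y: "dist x y = c * \<tau> n" "F y \<le> F x - c * (c * \<tau> n)"
      using desc(3)[of "c * \<tau> n"] b(3) by auto
    have b2: "2 * L * \<tau> n < \<rho>" "c * \<tau> n \<le> \<rho>" using b(1,2) ct \<rho> by linarith+
    show ?thesis
      by (rule proximal_point_exists[OF cpt lip L \<tau>(1) b2(1) desc(1) b2(2) y]) blast
  qed
  then obtain z where z: "\<And>n. dist x (z n) < \<rho>" "\<And>n. dist x (z n) \<le> 2 * L * \<tau> n"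
      "\<And>n. c\<^sup>2 / (2 * L) \<le> dist x (z n) / \<tau> n"
    and min: "\<And>n q. q \<in> cball x \<rho> \<Longrightarrow>
      F (z n) + (dist x (z n))\<^sup>2 / (2 * \<tau> n) \<le> F q + (dist x q)\<^sup>2 / (2 * \<tau> n)"
    by metis
  define s where "s n = dist x (z n)" for n
  have bound_lim: "(\<lambda>n. 2 * L * \<tau> n) \<longlonglongrightarrow> 0"
    using tendsto_mult_right_zero[OF \<open>\<tau> \<longlonglongrightarrow> 0\<close>] by simp
  have "\<forall>n. norm (s n) \<le> 2 * L * \<tau> n" using z(2) by (simp add: s_def)
  then have s_lim: "s \<longlonglongrightarrow> 0"
    by (rule Lim_null_comparison[OF always_eventually bound_lim])
  have pos: "0 < c\<^sup>2 / (2 * L)" using desc L by simp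
  have s0: "0 < s n" for n
    using less_le_trans[OF pos z(3)[of n]] \<tau>(1)[of n] by (simp add: s_def zero_less_divide_iff)
  have "\<forall>n. s n / \<tau> n \<in> {c\<^sup>2 / (2 * L)..2 * L}"
  proof
    fix n
    have "s n / \<tau> n \<le> 2 * L"
      using z(2)[of n] \<tau>(1)[of n] by (subst pos_divide_le_eq) (auto simp: s_def)
    then show "s n / \<tau> n \<in> {c\<^sup>2 / (2 * L)..2 * L}"
      using z(3)[of n] unfolding s_def atLeastAtMost_iff by blast
  qed
  \<comment> \<open>The ratios stay away from 0, so their limit \<open>m\<close> is positive. It is
    fixed before the extension length \<open>s'\<close>, as the conclusion demands.\<close>
  from compact_imp_seq_compact[OF compact_Icc, THEN seq_compactE, OF this]
  obtain m r where m: "m \<in> {c\<^sup>2 / (2 * L)..2 * L}" and r: "strict_mono r"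
    and m_lim: "(\<lambda>n. s (r n) / \<tau> (r n)) \<longlonglongrightarrow> m"
    by (auto simp: comp_def)
  have "0 < m" using m pos unfolding atLeastAtMost_iff by linarith
  moreover have "\<exists>w. dist x w = s' \<and> (\<forall>y\<in>cball x \<rho> - {x}.
      cos (k * dist w y) \<le> cos (k * s') * cos (k * dist x y)
        + sin (k * s') * ((F y - F x) * (sin (k * dist x y) / dist x y) / m))"
    if s': "0 < s'" "s' < \<rho>" for s'
  proof -
    \<comment> \<open>The extended geodesic has length \<open>R\<close>, at least
      \<open>2 * \<rho>\<close>, so it continues beyond \<open>x\<close> by more than
      \<open>s'\<close>.\<close>
    have "\<exists>\<eta>. geodesic (s n + s') \<eta> \<and> \<eta> 0 = z n \<and> \<eta> (s n) = x" for n
    proof -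
      have "4 * \<rho> < pi / k" using \<rho> k0 by (simp add: field_simps)
      then have "dist (z n) x < pi / sqrt \<kappa>"
        using z(1)[of n] \<rho> by (simp add: dist_commute flip: k)
      then obtain \<sigma> where \<sigma>: "geodesic (dist (z n) x) \<sigma>" "\<sigma> 0 = z n" "\<sigma> (dist (z n) x) = x"
        using CAT_space_geodesic[OF cat] by blast
      have "z n \<in> ball x R" "x \<in> ball x R" "z n \<noteq> x" "dist (z n) x < R"
        using z(1)[of n] s0[of n] \<rho> ext by (auto simp: s_def dist_commute)
      then obtain \<eta> where \<eta>: "geodesic R \<eta>" "\<forall>t\<in>{0..dist (z n) x}. \<eta> t = \<sigma> t"
        using ext(1) \<sigma> unfolding geodesic_extension_around_def by blast
      have "geodesic (s n + s') \<eta>"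
        using geodesic_in_restrict[OF \<eta>(1)] z(1)[of n] s0[of n] s' ext by (simp add: s_def)
      then show ?thesis using \<eta> \<sigma> by (auto simp: s_def dist_commute)
    qed
    then obtain \<eta> where \<eta>: "\<And>n. geodesic (s n + s') (\<eta> n)" "\<And>n. \<eta> n 0 = z n" "\<And>n. \<eta> n (s n) = x"
      by metis
    define w where "w n = \<eta> n (s n + s')" for n
    have xw: "dist x (w n) = s'" for n
    proof -
      have "dist (\<eta> n (s n)) (\<eta> n (s n + s')) = \<bar>s n - (s n + s')\<bar>"
        using \<eta>(1)[of n] s0[of n] s' unfolding geodesic_in_def by auto
      then show ?thesis using \<eta>(3)[of n] s' by (simp add: w_def)
    qed
    then have "\<forall>n. (w \<circ> r) n \<in> cball x \<rho>" using s' by simp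
    \<comment> \<open>Endpoints are selected within the subsequence \<open>r\<close>, so the ratios
      still converge to \<open>m\<close>.\<close>
    from compact_imp_seq_compact[OF cpt, THEN seq_compactE, OF this]
    obtain w0 r' where r': "strict_mono r'" and w0: "((w \<circ> r) \<circ> r') \<longlonglongrightarrow> w0"
      by blast
    define N where "N = r \<circ> r'"
    have N: "strict_mono N" using r r' by (simp add: N_def strict_mono_o)
    have w_lim: "(\<lambda>n. w (N n)) \<longlonglongrightarrow> w0" using w0 by (simp add: N_def o_def)
    have s_lim': "(\<lambda>n. s (N n)) \<longlonglongrightarrow> 0" using LIMSEQ_subseq_LIMSEQ[OF s_lim N] by (simp add: o_def)
    have m_lim': "(\<lambda>n. s (N n) / \<tau> (N n)) \<longlonglongrightarrow> m"
      using LIMSEQ_subseq_LIMSEQ[OF m_lim r'] by (simp add: o_def N_def)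
    have z_lim: "(\<lambda>n. z (N n)) \<longlonglongrightarrow> x"
      using s_lim' unfolding s_def by (subst tendsto_dist_iff) (simp add: dist_commute)
    have F_lim: "(\<lambda>n. F (z (N n))) \<longlonglongrightarrow> F x"
      using lipschitz_on_continuous_on[OF lip] z_lim z(1) \<rho>
      by (intro continuous_on_tendsto_compose[of "cball x \<rho>" F]) (auto intro!: always_eventually less_imp_le)
    have "(\<lambda>n. dist x (w (N n))) \<longlonglongrightarrow> dist x w0" by (intro tendsto_intros w_lim)
    then have "dist x w0 = s'" using xw by (simp add: LIMSEQ_const_iff)
    moreover have "cos (k * dist w0 y) \<le> cos (k * s') * cos (k * dist x y)
        + sin (k * s') * ((F y - F x) * (sin (k * dist x y) / dist x y) / m)"
      if y: "y \<in> cball x \<rho> - {x}" for y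
    proof -
      have zy: "(\<lambda>n. dist (z (N n)) y) \<longlonglongrightarrow> dist x y" by (intro tendsto_intros z_lim)
      have "0 < dist x y" using y by auto
      let ?f = "\<lambda>n. cos (k * s') * cos (k * dist x y)
        + sin (k * s') * (cos (k * s (N n)) * ((F y - F (z (N n))) *
            (sin (k * dist (z (N n)) y) / dist (z (N n)) y) / (s (N n) / \<tau> (N n)))
          - sin (k * s (N n)) * cos (k * dist (z (N n)) y))"
      have "?f \<longlonglongrightarrow> cos (k * s') * cos (k * dist x y)
        + sin (k * s') * (cos (k * 0) * ((F y - F x) * (sin (k * dist x y) / dist x y) / m)
          - sin (k * 0) * cos (k * dist x y))"
        using \<open>0 < m\<close> \<open>0 < dist x y\<close> by (intro tendsto_intros s_lim' zy m_lim' F_lim) auto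
      moreover have "(\<lambda>n. cos (k * dist (w (N n)) y)) \<longlonglongrightarrow> cos (k * dist w0 y)"
        by (intro tendsto_intros w_lim)
      moreover have "\<forall>\<^sub>F n in sequentially. cos (k * dist (w (N n)) y) \<le> ?f n"
        using order_tendstoD(1)[OF zy \<open>0 < dist x y\<close>]
      proof eventually_elim
        case (elim n)
        show ?case
          unfolding w_def
          by (rule steepest_ascent_point_approx[OF \<kappa> k cat \<rho>(2) conv z(1) _ min \<tau>(1) s_def \<eta> s'])
            (use elim y s0[of "N n"] in \<open>auto simp: s_def\<close>)
      qed
      ultimately show ?thesis by (auto dest: tendsto_le[OF sequentially_bot, rotated])
    qed
    ultimately show ?thesis by blast
  qed
  ultimately show thesis using that by blast
qed

section \<open>Normal cones and subgradients\<close>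

lemma proj_set_eq_singletonI:
  assumes "p \<in> C" "\<And>q. \<lbrakk>q \<in> C; q \<noteq> p\<rbrakk> \<Longrightarrow> dist z p < dist z q"
  shows "proj_set C z = {p}"
proof -
  have le: "dist z p \<le> dist z q" if "q \<in> C" for q
    using assms(2)[OF that] by (cases "q = p") auto
  then have "dist z p \<le> infdist z C"
    using assms(1) unfolding infdist_def by (auto intro!: cINF_greatest)
  then have "infdist z C = dist z p" using infdist_le[OF assms(1)] by (intro antisym)
  then show ?thesis using assms unfolding proj_set_def by (force dest: less_imp_neq)
qed

text \<open>Places a geodesic in its own direction class: along one geodesic the Euclidean
  comparison triangles are degenerate, so the argument of \<open>arccos\<close> is exactly
  1.\<close>

lemma alexandrov_angle_refl:
  assumes "geodesic l \<gamma>" "0 < l"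
  shows "alexandrov_angle \<gamma> \<gamma> = 0"
proof -
  let ?F = "at_right (0::real) \<times>\<^sub>F at_right (0::real)"
  let ?g = "\<lambda>(s, t). ereal (arccos ((s\<^sup>2 + t\<^sup>2 - (dist (\<gamma> s) (\<gamma> t))\<^sup>2) / (2 * s * t)))"
  have ev: "eventually (\<lambda>s::real. 0 < s \<and> s \<le> l) (at_right 0)"
    using assms by (auto simp: eventually_at_right_field intro!: exI[of _ l])
  have "eventually (\<lambda>p. ?g p = ereal 0) ?F"
    unfolding eventually_prod_filter
  proof (intro exI conjI allI impI)
    show "eventually (\<lambda>s::real. 0 < s \<and> s \<le> l) (at_right 0)"
      "eventually (\<lambda>s::real. 0 < s \<and> s \<le> l) (at_right 0)" by (rule ev)+
    fix s t :: real
    assume s: "0 < s \<and> s \<le> l" and t: "0 < t \<and> t \<le> l"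
    have "dist (\<gamma> s) (\<gamma> t) = \<bar>s - t\<bar>" using assms s t by (auto simp: geodesic_in_def)
    then have "s\<^sup>2 + t\<^sup>2 - (dist (\<gamma> s) (\<gamma> t))\<^sup>2 = 2 * s * t" by (simp add: power2_diff)
    then show "?g (s, t) = ereal 0" using s t by simp
  qed
  then have "Limsup ?F ?g = Limsup ?F (\<lambda>_. ereal 0)" by (rule Limsup_eq)
  also have "\<dots> = ereal 0" by (rule Limsup_const) (simp add: prod_filter_eq_bot)
  finally show ?thesis by (simp add: alexandrov_angle_def)
qed

lemma mem_direction_of_self:
  assumes "geodesic l \<gamma>" "\<gamma> 0 = x" "0 < l"
  shows "(l, \<gamma>) \<in> direction_of x l \<gamma>" "direction_of x l \<gamma> \<in> directions x"
proof -
  have g: "(l, \<gamma>) \<in> geodesics_from x" using assms by (simp add: geodesics_from_def)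
  then show "direction_of x l \<gamma> \<in> directions x"
    unfolding direction_of_def directions_def by (rule quotientI)
  show "(l, \<gamma>) \<in> direction_of x l \<gamma>"
    using g alexandrov_angle_refl[OF assms(1,3)] by (simp add: direction_of_def same_direction_def)
qed

lemma normal_coneI:
  assumes "geodesic l \<sigma>" "\<sigma> 0 = y" "0 < t" "t \<le> l" "proj_set C (\<sigma> t) = {y}" "0 < r"
  shows "Ray (direction_of y l \<sigma>) r \<in> normal_cone C y"
proof -
  have "0 < l" using assms by simp
  note m = mem_direction_of_self[OF assms(1,2) this]
  show ?thesis
    using m assms(3-6) unfolding normal_cone_def tangent_space_def
    by (auto intro!: bexI[of _ "(l, \<sigma>)"] bexI[of _ t])
qed

text \<open>The two components have constant speeds whose squares add up to 1. The assumption is a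
  distance identity so that it also covers the constant curve with \<open>r = 0\<close>.\<close>

lemma geodesic_downward_geodesic:
  fixes \<gamma> :: "real \<Rightarrow> 'a::metric_space"
  assumes "0 \<le> R"
    and "\<And>s t. \<lbrakk>s \<in> {0..R}; t \<in> {0..R}\<rbrakk> \<Longrightarrow>
      dist (\<gamma> (r * s / sqrt (r\<^sup>2 + 1))) (\<gamma> (r * t / sqrt (r\<^sup>2 + 1))) = r / sqrt (r\<^sup>2 + 1) * \<bar>s - t\<bar>"
  shows "geodesic R (downward_geodesic \<gamma> r a)"
proof -
  define q where "q = sqrt (r\<^sup>2 + 1)"
  have q: "0 < q" "q\<^sup>2 = r\<^sup>2 + 1" by (auto simp: q_def add_nonneg_pos)
  have "dist (downward_geodesic \<gamma> r a s) (downward_geodesic \<gamma> r a t) = \<bar>s - t\<bar>"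
    if st: "s \<in> {0..R}" "t \<in> {0..R}" for s t
  proof -
    have "a - s / q - (a - t / q) = - (s - t) / q" by (simp add: diff_divide_distrib)
    then have e: "(dist (a - s / q) (a - t / q))\<^sup>2 = (s - t)\<^sup>2 / q\<^sup>2"
      by (simp add: dist_real_def power_divide power2_commute)
    have "(r / q * \<bar>s - t\<bar>)\<^sup>2 + (s - t)\<^sup>2 / q\<^sup>2 = (s - t)\<^sup>2 * ((r\<^sup>2 + 1) / q\<^sup>2)"
      by (simp add: power_mult_distrib power_divide add_divide_distrib algebra_simps)
    also have "\<dots> = (s - t)\<^sup>2" using q by (simp flip: q(2))
    finally show ?thesis
      using assms(2)[OF st] e by (simp add: downward_geodesic_def dist_Pair_Pair flip: q_def)
  qed
  then show ?thesis using assms(1) by (simp add: geodesic_in_def)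
qed

section \<open>Local regularity of convex functions and the case of a minimiser\<close>

lemma geodesically_convex_fun_real:
  assumes "geodesically_convex_fun f" "geodesic l \<eta>" "0 < l" "e \<in> {0..l}"
    and "f (\<eta> 0) = ereal u" "f (\<eta> l) = ereal v" "f (\<eta> e) = ereal w"
  shows "w \<le> (1 - e / l) * u + e / l * v"
proof -
  have "e / l \<in> {0..1}" using assms(3,4) by simp
  then have "f (\<eta> (l * (e / l))) \<le> ereal (1 - e / l) * f (\<eta> 0) + ereal (e / l) * f (\<eta> l)"
    using assms(1,2) unfolding geodesically_convex_fun_def by blast
  then show ?thesis using assms(3,5-7) by simp
qed

text \<open>The geodesic from \<open>y\<close> to \<open>z\<close> is prolonged by
  \<open>\<epsilon> / 2\<close>, which stays in the larger ball. By convexity the slope up to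
  \<open>z\<close> is at most the slope over the whole, where \<open>F\<close> gains at most 2 over
  a length of at least \<open>\<epsilon> / 2\<close>.\<close>

lemma geodesically_convex_fun_lipschitz:
  fixes x :: "'a::metric_space"
  assumes cat: "CAT_space \<kappa> TYPE('a)" and ext: "geodesic_extension_around x R"
    and conv: "geodesically_convex_fun f"
    and \<epsilon>: "0 < \<epsilon>" "\<epsilon> \<le> R" "\<epsilon> \<le> pi / sqrt \<kappa>"
    and F: "\<And>y. y \<in> ball x \<epsilon> \<Longrightarrow> f y = ereal (F y)" "\<And>y. y \<in> ball x \<epsilon> \<Longrightarrow> \<bar>F y - a\<bar> < 1"
  shows "(4 / \<epsilon>)-lipschitz_on (ball x (\<epsilon> / 4)) F"
proof -
  have le: "F z - F y \<le> 4 / \<epsilon> * dist y z" if y: "y \<in> ball x (\<epsilon> / 4)" and z: "z \<in> ball x (\<epsilon> / 4)" for y z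
  proof (cases "y = z")
    case False
    define d where "d = dist y z"
    have d: "0 < d" "d < \<epsilon> / 2"
      using False y z dist_triangle3[of y z x] by (auto simp: d_def)
    have "dist y z < pi / sqrt \<kappa>" using d \<epsilon> unfolding d_def by linarith
    then obtain \<sigma> where \<sigma>: "geodesic (dist y z) \<sigma>" "\<sigma> 0 = y" "\<sigma> (dist y z) = z"
      using CAT_space_geodesic[OF cat] by blast
    have "y \<in> ball x R" "z \<in> ball x R" "dist y z < R"
      using y z d \<epsilon> by (auto simp: d_def)
    then obtain \<eta> where \<eta>: "geodesic R \<eta>" "\<forall>t\<in>{0..dist y z}. \<eta> t = \<sigma> t"
      using ext False \<sigma> unfolding geodesic_extension_around_def by blast
    define l where "l = d + \<epsilon> / 2"
    have l: "0 < l" "l \<le> R" using d \<epsilon> by (auto simp: l_def)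
    have \<eta>': "\<eta> 0 = y" "\<eta> d = z" using \<eta>(2) \<sigma> by (auto simp: d_def)
    have "dist (\<eta> d) (\<eta> l) = \<bar>d - l\<bar>"
      using \<eta>(1) l d \<epsilon> unfolding geodesic_in_def by (auto simp: l_def)
    then have "dist z (\<eta> l) = \<epsilon> / 2" using \<eta>' \<epsilon> by (simp add: l_def)
    then have w: "\<eta> l \<in> ball x \<epsilon>" using z dist_triangle[of x "\<eta> l" z] \<epsilon> by simp
    have yz: "y \<in> ball x \<epsilon>" "z \<in> ball x \<epsilon>" using y z \<epsilon> by auto
    have "F z \<le> (1 - d / l) * F y + d / l * F (\<eta> l)"
      using geodesically_convex_fun_real[OF conv geodesic_in_restrict[OF \<eta>(1)] l(1), of d]
        l d \<epsilon> \<eta>' F(1)[OF w] F(1)[OF yz(1)] F(1)[OF yz(2)] by (simp add: l_def)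
    then have "F z - F y \<le> d / l * (F (\<eta> l) - F y)" by (simp add: algebra_simps)
    also have "\<dots> \<le> d / l * 2"
      using F(2)[OF w] F(2)[OF yz(1)] d l by (intro mult_left_mono) auto
    also have "\<dots> \<le> d / (\<epsilon> / 2) * 2"
      using d \<epsilon> by (intro mult_right_mono divide_left_mono) (auto simp: l_def)
    also have "\<dots> = 4 / \<epsilon> * dist y z" by (simp add: d_def)
    finally show ?thesis .
  qed simp
  show ?thesis
  proof (rule lipschitz_onI)
    fix y z assume "y \<in> ball x (\<epsilon> / 4)" "z \<in> ball x (\<epsilon> / 4)"
    then show "dist (F y) (F z) \<le> 4 / \<epsilon> * dist y z"
      using le[of y z] le[of z y] by (simp add: dist_real_def abs_le_iff dist_commute)
  qed (use \<epsilon> in simp)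
qed

lemma Apex_mem_subdifferential:
  fixes x :: "'a::metric_space"
  assumes "0 < R" "f x = ereal a" "\<And>y. f x \<le> f y"
  shows "Apex \<in> subdifferential R f x"
proof -
  let ?\<sigma> = "downward_geodesic (\<lambda>_. x) 0 a"
  have \<sigma>: "geodesic R ?\<sigma>"
    using assms(1) by (intro geodesic_downward_geodesic) auto
  have "proj_set (epi f) (?\<sigma> R) = {(x, a)}"
  proof (rule proj_set_eq_singletonI)
    show "(x, a) \<in> epi f" using assms(2) by (simp add: epi_def eff_dom_def)
    fix q assume q: "q \<in> epi f" "q \<noteq> (x, a)"
    obtain y c where yc: "q = (y, c)" by force
    have "f y \<le> ereal c" using q(1) by (simp add: epi_def yc)
    then have "ereal a \<le> ereal c" using assms(3)[of y] unfolding assms(2) by (rule order_trans[rotated])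
    then have c: "a \<le> c" by simp
    have "R\<^sup>2 < (dist x y)\<^sup>2 + (R + (c - a))\<^sup>2"
    proof (cases "y = x")
      case True
      then have "a < c" using q c yc by auto
      then have "R\<^sup>2 < (R + (c - a))\<^sup>2" using assms(1) by (intro power_strict_mono) auto
      then show ?thesis using True by simp
    next
      case False
      have "R\<^sup>2 \<le> (R + (c - a))\<^sup>2" using assms(1) c by (intro power_mono) auto
      moreover have "0 < (dist x y)\<^sup>2" using False by simp
      ultimately show ?thesis by linarith
    qed
    moreover have "(dist (a - R) c)\<^sup>2 = (R + (c - a))\<^sup>2"
      by (simp add: dist_real_def power2_eq_square algebra_simps)
    ultimately have "R < dist (?\<sigma> R) (y, c)"
      using assms(1) by (simp add: downward_geodesic_def dist_Pair_Pair real_less_rsqrt)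
    then show "dist (?\<sigma> R) (x, a) < dist (?\<sigma> R) q"
      using assms(1) by (simp add: yc downward_geodesic_def dist_Pair_Pair dist_real_def)
  qed
  then have "Ray (direction_of (x, a) R ?\<sigma>) 1 \<in> normal_cone (epi f) (x, a)"
    using assms(1) by (intro normal_coneI[OF \<sigma>, where t = R]) (auto simp: downward_geodesic_def)
  then show ?thesis
    using assms(2) by (simp add: subdifferential_def tangent_space_def Let_def)
qed

theorem theorem4p11:
  fixes \<kappa> :: real and R :: "'a::metric_space \<Rightarrow> real" and f :: "'a \<Rightarrow> ereal" and x :: 'a
  assumes "\<kappa> > 0"
    and "locally_compact_space (euclidean :: 'a topology)"
    and "uniquely_geodesic TYPE('a)"
    and "CAT_space \<kappa> TYPE('a)"
    and "\<And>p. geodesic_extension_around p (R p)"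
    and "\<And>p. R p < pi / (2 * sqrt \<kappa>)"
    and "\<And>y. f y \<noteq> -\<infinity>"
    and "geodesically_convex_fun f"
    and "x \<in> eff_dom f"
    and "isCont f x"
  shows "subdifferential (R x) f x \<noteq> {}"
proof -
  define k where "k = sqrt \<kappa>"
  have k0: "0 < k" using assms(1) by (simp add: k_def)
  define r where "r = R x"
  have ext: "geodesic_extension_around x r" and r0: "0 < r" and r: "r < pi / (2 * k)"
    using assms(5,6)[of x] by (auto simp: r_def k_def geodesic_extension_around_def)
  \<comment> \<open>\<open>F\<close> is 0 where \<open>f\<close> is infinite; its values are used
    only where \<open>f\<close> is shown to be finite.\<close>
  define F where "F y = real_of_ereal (f y)" for y
  define a where "a = F x"
  have fin: "f y = ereal (F y)" if "f y < \<infinity>" for y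
    using that assms(7)[of y] by (cases "f y") (auto simp: F_def)
  have fx: "f x = ereal a" using fin[of x] assms(9) by (simp add: eff_dom_def a_def)
  show ?thesis
  proof (cases "\<forall>y. f x \<le> f y")
    case True
    have "Apex \<in> subdifferential r f x"
      by (rule Apex_mem_subdifferential[where a = a]) (use r0 fx True in auto)
    then show ?thesis by (auto simp: r_def)
  next
    case False
    then obtain y0 where y0: "f y0 < f x" by (auto simp: not_le)
    then have fy: "f y0 = ereal (F y0)" using less_le_trans[of "f y0" "f x" \<infinity>] by (intro fin) simp
    then have fy0: "f y0 = ereal (F y0)" "F y0 < a" using y0 fx by auto
    have "\<exists>!S. geodesic_segment x y0 S" using assms(3) by (simp add: uniquely_geodesic_def)
    then obtain S where "geodesic_segment x y0 S" by (elim ex1E)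
    then obtain l \<gamma>0 where \<gamma>0: "geodesic l \<gamma>0" "\<gamma>0 0 = x" "\<gamma>0 l = y0"
      unfolding geodesic_segment_def by (elim exE conjE)
    have "l \<noteq> 0" using \<gamma>0 y0 by auto
    then have l0: "0 < l" using \<gamma>0(1) by (simp add: geodesic_in_def)

    \<comment> \<open>Finiteness, Lipschitz bound and a compact ball near \<open>x\<close>\<close>
    have "(f \<longlongrightarrow> f x) (nhds x)"
      using assms(10) by (simp add: isCont_def tendsto_at_iff_tendsto_nhds)
    then have "eventually (\<lambda>y. ereal (a - 1) < f y) (nhds x)" "eventually (\<lambda>y. f y < ereal (a + 1)) (nhds x)"
      by (auto intro!: order_tendstoD simp: fx)
    then have "eventually (\<lambda>y. ereal (a - 1) < f y \<and> f y < ereal (a + 1)) (nhds x)"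
      by (rule eventually_conj)
    then obtain \<epsilon>0 where \<epsilon>0: "0 < \<epsilon>0"
      "\<And>y. dist y x < \<epsilon>0 \<Longrightarrow> ereal (a - 1) < f y \<and> f y < ereal (a + 1)"
      unfolding eventually_nhds_metric by blast
    have near: "f y = ereal (F y)" "\<bar>F y - a\<bar> < 1" if "y \<in> ball x \<epsilon>0" for y
    proof -
      have d: "ereal (a - 1) < f y" "f y < ereal (a + 1)"
        using \<epsilon>0(2)[of y] that by (auto simp: dist_commute)
      show e: "f y = ereal (F y)" using less_trans[OF d(2), of \<infinity>] by (intro fin) auto
      show "\<bar>F y - a\<bar> < 1" using d unfolding e by auto
    qed
    obtain U K where U: "open U" "compact K" "x \<in> U" "U \<subseteq> K"
      using assms(2) unfolding locally_compact_space_def by simp meson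
    obtain \<epsilon>1 where \<epsilon>1: "0 < \<epsilon>1" "cball x \<epsilon>1 \<subseteq> U"
      using U(1,3) open_contains_cball by blast
    define \<epsilon> where "\<epsilon> = min r \<epsilon>0"
    have \<epsilon>: "0 < \<epsilon>" "\<epsilon> \<le> r" "\<epsilon> \<le> \<epsilon>0" using r0 \<epsilon>0 by (auto simp: \<epsilon>_def)
    have kr: "k * r < pi / 2" using r k0 by (simp add: field_simps)
    have "r < pi / k"
      using r k0 divide_strict_left_mono[of k "2 * k" pi] by simp
    then have lip': "(4 / \<epsilon>)-lipschitz_on (ball x (\<epsilon> / 4)) F"
      using \<epsilon> near
      by (intro geodesically_convex_fun_lipschitz[OF assms(4) ext assms(8), where a = a]) (auto simp: k_def)
    define \<rho> where "\<rho> = min (\<epsilon> / 8) \<epsilon>1"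
    have \<rho>: "0 < \<rho>" "\<rho> \<le> \<epsilon> / 8" "\<rho> \<le> \<epsilon>1" using \<epsilon> \<epsilon>1 by (auto simp: \<rho>_def)
    have lip: "(4 / \<epsilon>)-lipschitz_on (cball x \<rho>) F"
      by (rule lipschitz_on_subset[OF lip']) (use \<rho> \<epsilon> in auto)
    have near\<rho>: "f y = ereal (F y)" if "y \<in> cball x \<rho>" for y
      using that \<rho> \<epsilon> by (intro near) auto
    have "cball x \<rho> \<subseteq> cball x \<epsilon>1" using \<rho> by auto
    then have "cball x \<rho> \<subseteq> K" using U(4) \<epsilon>1(2) by blast
    then have "K \<inter> cball x \<rho> = cball x \<rho>" by blast
    then have cpt: "compact (cball x \<rho>)" using compact_Int_closed[OF U(2) closed_cball, of x \<rho>] by simp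
    have "k * \<rho> \<le> k * (r / 8)" using \<rho> \<epsilon> k0 by (intro mult_left_mono) auto
    then have k\<rho>: "k * \<rho> < pi / 4" using kr pi_gt_zero by (simp only: times_divide_eq_right)
    have conv: "F (\<eta> e) \<le> (1 - e / l) * F (\<eta> 0) + e / l * F (\<eta> l)"
      if "geodesic l \<eta>" "0 < l" "\<eta> 0 \<in> cball x \<rho>" "\<eta> l \<in> cball x \<rho>" "e \<in> {0..l}" "\<eta> e \<in> cball x \<rho>"
      for \<eta> l e
      using that near\<rho> by (intro geodesically_convex_fun_real[OF assms(8)])
    \<comment> \<open>The mean rate of decrease of \<open>f\<close> from \<open>x\<close> to
      \<open>y0\<close>; convexity guarantees at least this rate on every initial piece of the
      geodesic.\<close>
    define c where "c = (a - F y0) / l"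
    have c: "0 < c" using fy0 l0 by (simp add: c_def)
    have desc: "\<exists>y. dist x y = t \<and> F y \<le> F x - c * t" if t: "0 < t" "t < min l \<rho>" for t
    proof -
      have d: "dist x (\<gamma>0 t) = t" using \<gamma>0(1,2) t by (auto simp: geodesic_in_def)
      have "F (\<gamma>0 t) \<le> (1 - t / l) * a + t / l * F y0"
        using d t \<gamma>0 fx fy0 near\<rho>[of "\<gamma>0 t"]
        by (intro geodesically_convex_fun_real[OF assms(8) \<gamma>0(1) l0]) auto
      also have "\<dots> = F x - c * t" using l0 by (simp add: c_def a_def field_simps)
      finally show ?thesis using d by blast
    qed
    have bounds: "0 < 4 / \<epsilon>" "2 * \<rho> \<le> r" "0 < min l \<rho>" using \<rho> \<epsilon> l0 by auto
    obtain m where m: "0 < m"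
      and asc: "\<And>s. \<lbrakk>0 < s; s < \<rho>\<rbrakk> \<Longrightarrow> \<exists>w. dist x w = s \<and> (\<forall>y\<in>cball x \<rho> - {x}.
        cos (k * dist w y) \<le> cos (k * s) * cos (k * dist x y)
          + sin (k * s) * ((F y - F x) * (sin (k * dist x y) / dist x y) / m))"
      by (rule steepest_ascent_point_exists[OF assms(1) k_def assms(4) \<rho>(1) k\<rho> cpt lip bounds(1)
            _ ext bounds(2) c bounds(3)]) ((rule conv; assumption), (rule desc; assumption), (rule that, assumption, blast))

    \<comment> \<open>Choice of the scale\<close>
    define q where "q = sqrt (m\<^sup>2 + 1)"
    define p where "p = q / m"
    have q: "0 < q" "q\<^sup>2 = m\<^sup>2 + 1" by (auto simp: q_def add_nonneg_pos)
    have p: "0 < p" "p\<^sup>2 = 1 + (1 / m)\<^sup>2"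
      using q m by (auto simp: p_def power_divide field_simps)
    \<comment> \<open>The downward geodesic of slope \<open>m\<close> is over \<open>w\<close> at
      time \<open>s * p\<close>. With \<open>t = s * p\<close>, the three bounds keep competing base
      points in the ball, make all scaled distances small, and give
      \<open>k * s / m \<le> 1\<close>.\<close>
    define s where "s = min (\<rho> / (2 * (1 + p))) (min (1 / (2 * k * (1 + p))) (m / k))"
    have s0: "0 < s" using \<rho> p k0 m by (simp add: s_def)
    have s1: "s \<le> \<rho> / (2 * (1 + p))" "s \<le> 1 / (2 * k * (1 + p))" "s \<le> m / k" by (auto simp: s_def)
    define t where "t = s * p"
    have t0: "0 < t" using s0 p by (simp add: t_def)
    have "s * (2 * (1 + p)) \<le> \<rho>" "s * (2 * k * (1 + p)) \<le> 1" "s * k \<le> m"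
      using s1 p k0 by (simp_all add: pos_le_divide_eq)
    then have st: "2 * (s + t) \<le> \<rho>" "k * (s + t) \<le> 1 / 2" "k * s / m \<le> 1"
      using m by (simp_all add: t_def algebra_simps)
    have ks: "k * s \<le> 1 / 2" "k * t \<le> 1 / 2" using st(2) s0 t0 k0 by (auto simp: distrib_left intro: order_trans[rotated])
    obtain w where w: "dist x w = s"
      and asc_w: "\<And>y. y \<in> cball x \<rho> - {x} \<Longrightarrow>
        cos (k * dist w y) \<le> cos (k * s) * cos (k * dist x y)
          + sin (k * s) * ((F y - F x) * (sin (k * dist x y) / dist x y) / m)"
      using asc[of s] s0 st t0 by auto

    \<comment> \<open>The geodesic through \<open>w\<close> and its downward lift\<close>
    have "s < pi / sqrt \<kappa>" using st(1) s0 t0 \<rho> \<epsilon> \<open>r < pi / k\<close> by (simp flip: k_def)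
    then obtain \<sigma> where \<sigma>: "geodesic (dist x w) \<sigma>" "\<sigma> 0 = x" "\<sigma> (dist x w) = w"
      using CAT_space_geodesic[OF assms(4), of x w] w by auto
    \<comment> \<open>The geodesic is prolonged to length \<open>r\<close>, since
      \<open>subdifferential\<close> asks for a representative at least that long.\<close>
    have "x \<in> ball x r" "w \<in> ball x r" "x \<noteq> w" "dist x w < r"
      using w s0 t0 st(1) \<rho> \<epsilon> r0 by auto
    then obtain \<gamma> where \<gamma>: "geodesic r \<gamma>" "\<forall>t\<in>{0..dist x w}. \<gamma> t = \<sigma> t"
      using ext \<sigma> unfolding geodesic_extension_around_def by blast
    have \<gamma>': "\<gamma> 0 = x" "\<gamma> s = w" using \<gamma>(2) \<sigma> w s0 by auto
    let ?D = "downward_geodesic \<gamma> m a"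
    have D: "geodesic r ?D"
    proof (rule geodesic_downward_geodesic)
      fix u v assume uv: "u \<in> {0..r}" "v \<in> {0..r}"
      have mq: "0 < m / q" "m / q \<le> 1"
        using m q by (auto simp: q_def intro!: real_le_rsqrt)
      have "m * u' / q \<in> {0..r}" if "u' \<in> {0..r}" for u'
      proof -
        have "m / q * u' \<le> 1 * r" using mq that by (intro mult_mono) auto
        moreover have "0 \<le> m / q * u'" using mq that by (intro mult_nonneg_nonneg) auto
        ultimately show ?thesis by simp
      qed
      then have "m * u / q \<in> {0..r}" "m * v / q \<in> {0..r}" using uv by blast+
      then have "dist (\<gamma> (m * u / q)) (\<gamma> (m * v / q)) = \<bar>m * u / q - m * v / q\<bar>"
        using \<gamma>(1) unfolding geodesic_in_def by blast
      also have "m * u / q - m * v / q = m / q * (u - v)" by (simp add: right_diff_distrib diff_divide_distrib)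
      finally show "dist (\<gamma> (m * u / sqrt (m\<^sup>2 + 1))) (\<gamma> (m * v / sqrt (m\<^sup>2 + 1)))
        = m / sqrt (m\<^sup>2 + 1) * \<bar>u - v\<bar>"
        using m q(1) by (simp add: abs_mult flip: q_def)
    qed (use r0 in simp)
    have D0: "?D 0 = (x, a)" using \<gamma>' by (simp add: downward_geodesic_def)
    have Dt: "?D t = (w, a - s / m)"
      using \<gamma>' q m by (simp add: downward_geodesic_def t_def p_def flip: q_def)
    have tr: "t \<le> r" using st(1) s0 t0 \<rho> \<epsilon> by simp
    have t2: "t\<^sup>2 = s\<^sup>2 + (s / m)\<^sup>2" by (simp add: t_def power_mult_distrib p power_divide algebra_simps)
    have "dist (?D t) (?D 0) = t" using D t0 tr r0 by (auto simp: geodesic_in_def)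
    then have distx: "dist (?D t) (x, a) = t" by (simp add: D0)

    \<comment> \<open>Uniqueness of the nearest point\<close>
    have "proj_set (epi f) (?D t) = {(x, a)}"
    proof (rule proj_set_eq_singletonI)
      show "(x, a) \<in> epi f" using fx by (simp add: epi_def eff_dom_def)
      fix z assume z: "z \<in> epi f" "z \<noteq> (x, a)"
      obtain y b where yb: "z = (y, b)" by force
      have fy: "f y = ereal (F y)" "F y \<le> b"
        using z(1) fin[of y] by (auto simp: yb epi_def eff_dom_def)
      have sq: "(dist (a - s / m) b)\<^sup>2 = (s / m + (b - a))\<^sup>2"
        by (simp add: dist_real_def power2_eq_square algebra_simps)
      have "t\<^sup>2 < (dist w y)\<^sup>2 + (s / m + (b - a))\<^sup>2"
      proof (cases "y = x")
        case True
        then have "a < b" using z(2) yb fy by (auto simp: a_def)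
        then have "(s / m)\<^sup>2 < (s / m + (b - a))\<^sup>2" using s0 m by (intro power_strict_mono) auto
        then show ?thesis using True w t2 by (simp add: dist_commute)
      next
        case False
        \<comment> \<open>Base points farther than \<open>t\<close> from \<open>w\<close> lose the
          comparison already by their horizontal distance. The others are within
          \<open>s + t\<close> of \<open>x\<close>, hence in the ball where the local estimate
          holds.\<close>
        show ?thesis
        proof (cases "dist w y \<le> t")
          case near_w: True
          have xy: "0 < dist x y" "dist x y \<le> s + t"
            using False w near_w dist_triangle[of x y w] by auto
          have "k * dist x y \<le> k * (s + t)" "k * dist w y \<le> k * t"
            using xy near_w k0 by (auto intro!: mult_left_mono)
          then have small: "k * dist x y \<le> 1" "k * dist w y \<le> pi"
            using st(2) ks pi_gt3 by linarith+
          have "y \<in> cball x \<rho> - {x}" using xy st(1) s0 t0 False by auto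
          \<comment> \<open>Inserting \<open>k\<close> in numerator and denominator puts the bound
            in the scaled form with \<open>G = k * (F y - a)\<close>; the factor
            \<open>k\<^sup>2\<close> is cancelled at the end.\<close>
          from asc_w[OF this]
          have "cos (k * dist w y) \<le> cos (k * s) * cos (k * dist x y)
            + sin (k * s) * (k * (F y - a) * (sin (k * dist x y) / (k * dist x y)) / m)"
            using k0 by (simp add: a_def)
          moreover have "k * (F y - a) \<le> k * (b - a)" using fy k0 by (intro mult_left_mono) auto
          ultimately have "(k * s)\<^sup>2 + (k * s / m)\<^sup>2 < (k * dist w y)\<^sup>2 + (k * s / m + k * (b - a))\<^sup>2"
            using s0 k0 ks small xy m st(3)
            by (intro spherical_subgradient_estimate[of "k * s" "k * dist x y" "k * dist w y" m "k * (F y - a)"])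
              auto
          then have "k\<^sup>2 * t\<^sup>2 < k\<^sup>2 * ((dist w y)\<^sup>2 + (s / m + (b - a))\<^sup>2)"
            unfolding t2 by (simp add: algebra_simps power2_eq_square)
          then show ?thesis using k0 by simp
        next
          case False
          then have "t\<^sup>2 < (dist w y)\<^sup>2" using t0 by (intro power_strict_mono) auto
          then show ?thesis using zero_le_power2[of "s / m + (b - a)"] by linarith
        qed
      qed
      then have "t < dist (?D t) z"
        unfolding Dt yb dist_Pair_Pair sq by (rule real_less_rsqrt)
      then show "dist (?D t) (x, a) < dist (?D t) z" using distx by simp
    qed
    then have "Ray (direction_of (x, a) r ?D) 1 \<in> normal_cone (epi f) (x, a)"
      using t0 tr by (intro normal_coneI[OF D D0]) auto
    moreover have "(r, \<gamma>) \<in> direction_of x r \<gamma>" "direction_of x r \<gamma> \<in> directions x"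
      using mem_direction_of_self[OF \<gamma>(1) \<gamma>'(1) r0] by auto
    ultimately have "Ray (direction_of x r \<gamma>) m \<in> subdifferential r f x"
      using fx m by (auto simp: subdifferential_def tangent_space_def Let_def intro!: bexI[of _ "(r, \<gamma>)"])
    then show ?thesis by (auto simp: r_def)
  qed
qed

end
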